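(* Let $(M,g)$ be a smooth, non-compact, complete, boundaryless, connected Riemannian manifold. For every ray $\gamma:[0,+\infty)\to M$, the Busemann function $b_\gamma:M\to\mathbb{R}$ is a (globally defined) viscosity solution on $M$ of the Hamilton-Jacobi equation $|\nabla u|_g=1$, or equivalently of $|du|_g^2=1$. Consequently, $b_\gamma$ is locally semi-concave with linear modulus on $M$.
   Context: $d$ is the Riemannian distance on $M$, $|\cdot|_g$ the norm induced by $g$ on $TM$ and $T^*M$, and $\nabla$ the gradient determined by $g$. Geodesic segments are parameterized by unit speed. A ray is a geodesic $\gamma:[0,+\infty)\to M$ with $d(\gamma(t_1),\gamma(t_2))=|t_2-t_1|$ for all $t_1,t_2\ge 0$. The Busemann function of a ray $\gamma$ is $b_\gamma(x)=\lim_{t\to+\infty}[d(x,\gamma(t))-t]$. Viscosity solution (standard definition): a continuous $u$ is a viscosity solution of $|\nabla u|_g=1$ on $M$ if for every $x\in M$ and every $C^1$ function $\phi$ defined near $x$: if $u-\phi$ has a local maximum at $x$ then $|\nabla\phi(x)|_g\le 1$, and if $u-\phi$ has a local minimum at $x$ then $|\nabla \phi(x)|_g\ge 1$. Similarly for $|du|_g^2=1$, with $|d\phi(x)|_g^2$ in place of $|\nabla\phi(x)|_g$. Local semi-concavity: for open $\Omega\subset\mathbb{R}^n$, a continuous $u:\Omega\to\mathbb{R}$ is locally semi-concave with linear modulus if for any open convex $\Omega'$ compactly contained in $\Omega$ there is a constant $C$ such that $u(x)-\frac{C}{2}|x|^2$ is concave on $\Omega'$ ($|\cdot|$ the Euclidean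 norm). A continuous $u:M\to\mathbb{R}$ is locally semi-concave with linear modulus if for any $x\in M$ there are an open neighborhood $U$ of $x$ and a smooth coordinate chart $\phi:U\to\mathbb{R}^n$ such that $u\circ\phi^{-1}$ is locally semi-concave with linear modulus on $\phi(U)$. *)

theory Defs
  imports "HOL-Analysis.Analysis"
begin

section \<open>Differentiability classes on open subsets of Euclidean spaces\<close>

text \<open>Meaningful for open \<open>S\<close>; in finite dimension, continuity of all directional derivatives
  is continuity of the derivative.\<close>

primrec C_k_on :: "nat \<Rightarrow> ('a::euclidean_space \<Rightarrow> 'b::real_normed_vector) \<Rightarrow> 'a set \<Rightarrow> bool" where
  "C_k_on 0 = (\<lambda>f S. continuous_on S f)"
| "C_k_on (Suc k) = (\<lambda>f S. (\<forall>x\<in>S. f differentiable (at x)) \<and>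
     (\<forall>v. C_k_on k (\<lambda>x. frechet_derivative f (at x) v) S))"

definition smooth_on :: "('a::euclidean_space \<Rightarrow> 'b::real_normed_vector) \<Rightarrow> 'a set \<Rightarrow> bool" where
  "smooth_on f S \<longleftrightarrow> (\<forall>k. C_k_on k f S)"


section \<open>Smooth manifolds\<close>

text \<open>The manifold is the whole type \<open>'m\<close> (Hausdorff and second countable whenever it is used
  below), modelled on the Euclidean space \<open>'e\<close>. A chart is a pair \<open>(U, \<phi>)\<close>; the values of \<open>\<phi>\<close>
  outside \<open>U\<close> are irrelevant.\<close>

type_synonym ('m, 'e) chart = "'m set \<times> ('m \<Rightarrow> 'e)"

abbreviation chart_dom :: "('m, 'e) chart \<Rightarrow> 'm set" where
  "chart_dom c \<equiv> fst c"

abbreviation chart_map :: "('m, 'e) chart \<Rightarrow> 'm \<Rightarrow> 'e" where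
  "chart_map c \<equiv> snd c"

definition chart_inv :: "('m, 'e) chart \<Rightarrow> 'e \<Rightarrow> 'm" where
  "chart_inv c = inv_into (chart_dom c) (chart_map c)"

definition is_chart :: "('m::topological_space, 'e::euclidean_space) chart \<Rightarrow> bool" where
  "is_chart c \<longleftrightarrow> open (chart_dom c) \<and> open (chart_map c ` chart_dom c) \<and>
     homeomorphism (chart_dom c) (chart_map c ` chart_dom c) (chart_map c) (chart_inv c)"

definition smoothly_compatible ::
    "('m::topological_space, 'e::euclidean_space) chart \<Rightarrow> ('m, 'e) chart \<Rightarrow> bool" where
  "smoothly_compatible c c' \<longleftrightarrow>
     smooth_on (chart_map c' \<circ> chart_inv c) (chart_map c ` (chart_dom c \<inter> chart_dom c')) \<and>
     smooth_on (chart_map c \<circ> chart_inv c') (chart_map c' ` (chart_dom c \<inter> chart_dom c'))"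

text \<open>A smooth structure is a maximal smooth atlas, so its elements are exactly the smooth
  coordinate charts.\<close>

definition smooth_structure :: "('m::topological_space, 'e::euclidean_space) chart set \<Rightarrow> bool" where
  "smooth_structure A \<longleftrightarrow>
     (\<forall>c\<in>A. is_chart c) \<and>
     (\<Union>c\<in>A. chart_dom c) = UNIV \<and>
     (\<forall>c\<in>A. \<forall>c'\<in>A. smoothly_compatible c c') \<and>
     (\<forall>c. is_chart c \<and> (\<forall>c'\<in>A. smoothly_compatible c c') \<longrightarrow> c \<in> A)"

definition charts_at :: "('m, 'e) chart set \<Rightarrow> 'm \<Rightarrow> ('m, 'e) chart set" where
  "charts_at A p = {c \<in> A. p \<in> chart_dom c}"

definition C1_on ::
    "('m::topological_space, 'e::euclidean_space) chart set \<Rightarrow> ('m \<Rightarrow> real) \<Rightarrow> 'm set \<Rightarrow> bool" where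
  "C1_on A f N \<longleftrightarrow> open N \<and>
     (\<forall>c\<in>A. C_k_on 1 (f \<circ> chart_inv c) (chart_map c ` (N \<inter> chart_dom c)))"


section \<open>Tangent vectors and covectors\<close>

text \<open>A tangent vector at \<open>p\<close> is the family of its components in all charts around \<open>p\<close>, subject to
  the transformation law of vectors. Components in the remaining charts are set to zero, so that
  two tangent vectors at \<open>p\<close> are equal iff they are equal as functions.\<close>

type_synonym ('m, 'e) tvec = "('m, 'e) chart \<Rightarrow> 'e"

definition tangent_space ::
    "('m, 'e::euclidean_space) chart set \<Rightarrow> 'm \<Rightarrow> ('m, 'e) tvec set" where
  "tangent_space A p = {v.
     (\<forall>c. c \<notin> charts_at A p \<longrightarrow> v c = 0) \<and>
     (\<forall>c\<in>charts_at A p. \<forall>c'\<in>charts_at A p.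
        v c' = frechet_derivative (chart_map c' \<circ> chart_inv c) (at (chart_map c p)) (v c))}"

text \<open>The tangent vector at \<open>p\<close> with components \<open>a\<close> in the chart \<open>c\<close>.\<close>

definition coord_vec ::
    "('m, 'e::euclidean_space) chart set \<Rightarrow> ('m, 'e) chart \<Rightarrow> 'm \<Rightarrow> 'e \<Rightarrow> ('m, 'e) tvec" where
  "coord_vec A c p a = (\<lambda>c'. if c' \<in> charts_at A p
     then frechet_derivative (chart_map c' \<circ> chart_inv c) (at (chart_map c p)) a else 0)"

text \<open>The differential \<open>df\<^sub>p\<close> as a linear form on the tangent space; it does not depend on the
  chart chosen.\<close>

definition differential ::
    "('m, 'e::euclidean_space) chart set \<Rightarrow> ('m \<Rightarrow> real) \<Rightarrow> 'm \<Rightarrow> ('m, 'e) tvec \<Rightarrow> real" where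
  "differential A f p v =
     (let c = (SOME c. c \<in> charts_at A p)
      in frechet_derivative (f \<circ> chart_inv c) (at (chart_map c p)) (v c))"

text \<open>The velocity at time \<open>t\<close> of a curve defined on the interval \<open>I\<close> (one-sided at end points
  belonging to \<open>I\<close>).\<close>

definition velocity ::
    "('m, 'e::euclidean_space) chart set \<Rightarrow> (real \<Rightarrow> 'm) \<Rightarrow> real set \<Rightarrow> real \<Rightarrow> ('m, 'e) tvec" where
  "velocity A \<gamma> I t = (\<lambda>c. if c \<in> charts_at A (\<gamma> t)
     then vector_derivative (chart_map c \<circ> \<gamma>) (at t within I) else 0)"


section \<open>Riemannian metrics\<close>

type_synonym ('m, 'e) metric_tensor = "'m \<Rightarrow> ('m, 'e) tvec \<Rightarrow> ('m, 'e) tvec \<Rightarrow> real"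

definition metric_coords ::
    "('m, 'e::euclidean_space) chart set \<Rightarrow> ('m, 'e) metric_tensor \<Rightarrow> ('m, 'e) chart
       \<Rightarrow> 'e \<Rightarrow> 'e \<Rightarrow> 'e \<Rightarrow> real" where
  "metric_coords A g c x a b =
     g (chart_inv c x) (coord_vec A c (chart_inv c x) a) (coord_vec A c (chart_inv c x) b)"

definition riemannian_metric ::
    "('m, 'e::euclidean_space) chart set \<Rightarrow> ('m, 'e) metric_tensor \<Rightarrow> bool" where
  "riemannian_metric A g \<longleftrightarrow>
     (\<forall>p. \<forall>v\<in>tangent_space A p. \<forall>w\<in>tangent_space A p. g p v w = g p w v) \<and>
     (\<forall>p. \<forall>u\<in>tangent_space A p. \<forall>v\<in>tangent_space A p. \<forall>w\<in>tangent_space A p. \<forall>r s.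
        g p (\<lambda>c. r *\<^sub>R u c + s *\<^sub>R v c) w = r * g p u w + s * g p v w) \<and>
     (\<forall>p. \<forall>v\<in>tangent_space A p. v \<noteq> (\<lambda>c. 0) \<longrightarrow> g p v v > 0) \<and>
     (\<forall>c\<in>A. \<forall>a b. smooth_on (\<lambda>x. metric_coords A g c x a b) (chart_map c ` chart_dom c))"

definition riemannian_manifold ::
    "('m::{t2_space, second_countable_topology}, 'e::euclidean_space) chart set
       \<Rightarrow> ('m, 'e) metric_tensor \<Rightarrow> bool" where
  "riemannian_manifold A g \<longleftrightarrow> smooth_structure A \<and> riemannian_metric A g"

definition tangent_norm :: "('m, 'e) metric_tensor \<Rightarrow> 'm \<Rightarrow> ('m, 'e) tvec \<Rightarrow> real" where
  "tangent_norm g p v = sqrt (g p v v)"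

text \<open>The norm on \<open>T\<^sup>*M\<close> induced by \<open>g\<close> is the dual norm.\<close>

definition cotangent_norm ::
    "('m, 'e::euclidean_space) chart set \<Rightarrow> ('m, 'e) metric_tensor \<Rightarrow> 'm
       \<Rightarrow> (('m, 'e) tvec \<Rightarrow> real) \<Rightarrow> real" where
  "cotangent_norm A g p \<xi> = Sup {\<bar>\<xi> v\<bar> |v. v \<in> tangent_space A p \<and> tangent_norm g p v \<le> 1}"

definition gradient ::
    "('m, 'e::euclidean_space) chart set \<Rightarrow> ('m, 'e) metric_tensor \<Rightarrow> ('m \<Rightarrow> real) \<Rightarrow> 'm
       \<Rightarrow> ('m, 'e) tvec" where
  "gradient A g f p = (THE w. w \<in> tangent_space A p \<and>
     (\<forall>v\<in>tangent_space A p. g p w v = differential A f p v))"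


section \<open>Riemannian distance\<close>

definition C1_curve ::
    "('m::topological_space, 'e::euclidean_space) chart set \<Rightarrow> (real \<Rightarrow> 'm) \<Rightarrow> real \<Rightarrow> real \<Rightarrow> bool" where
  "C1_curve A \<gamma> a b \<longleftrightarrow> a < b \<and> continuous_on {a..b} \<gamma> \<and>
     (\<forall>c\<in>A.
        (\<forall>t\<in>{a..b}. \<gamma> t \<in> chart_dom c \<longrightarrow> (chart_map c \<circ> \<gamma>) differentiable (at t within {a..b})) \<and>
        continuous_on {t\<in>{a..b}. \<gamma> t \<in> chart_dom c}
          (\<lambda>t. vector_derivative (chart_map c \<circ> \<gamma>) (at t within {a..b})))"

definition piecewise_C1_curve ::
    "('m::topological_space, 'e::euclidean_space) chart set \<Rightarrow> (real \<Rightarrow> 'm) \<Rightarrow> real \<Rightarrow> real \<Rightarrow> bool" where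
  "piecewise_C1_curve A \<gamma> a b \<longleftrightarrow>
     (\<exists>n (\<tau> :: nat \<Rightarrow> real). \<tau> 0 = a \<and> \<tau> n = b \<and> (\<forall>i<n. C1_curve A \<gamma> (\<tau> i) (\<tau> (Suc i))))"

text \<open>The velocity need not exist at the finitely many break points, which do not affect the
  integral.\<close>

definition curve_length ::
    "('m, 'e::euclidean_space) chart set \<Rightarrow> ('m, 'e) metric_tensor \<Rightarrow> (real \<Rightarrow> 'm)
       \<Rightarrow> real \<Rightarrow> real \<Rightarrow> real" where
  "curve_length A g \<gamma> a b = integral {a..b} (\<lambda>t. tangent_norm g (\<gamma> t) (velocity A \<gamma> {a..b} t))"

definition riemannian_dist ::
    "('m::topological_space, 'e::euclidean_space) chart set \<Rightarrow> ('m, 'e) metric_tensor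
       \<Rightarrow> 'm \<Rightarrow> 'm \<Rightarrow> real" where
  "riemannian_dist A g p q =
     Inf {curve_length A g \<gamma> a b |\<gamma> a b. piecewise_C1_curve A \<gamma> a b \<and> \<gamma> a = p \<and> \<gamma> b = q}"

definition complete_riemannian ::
    "('m::topological_space, 'e::euclidean_space) chart set \<Rightarrow> ('m, 'e) metric_tensor \<Rightarrow> bool" where
  "complete_riemannian A g \<longleftrightarrow> Metric_space.mcomplete UNIV (riemannian_dist A g)"


section \<open>Geodesics, rays and Busemann functions\<close>

text \<open>\<open>christoffel A g c x a b\<close> is the vector with components \<open>\<Gamma>\<^sup>k\<^sub>i\<^sub>j a\<^sup>i b\<^sup>j\<close> in the chart \<open>c\<close>; the
  index \<open>k\<close> is lowered with the metric to avoid choosing a basis.\<close>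

definition christoffel ::
    "('m, 'e::euclidean_space) chart set \<Rightarrow> ('m, 'e) metric_tensor \<Rightarrow> ('m, 'e) chart
       \<Rightarrow> 'e \<Rightarrow> 'e \<Rightarrow> 'e \<Rightarrow> 'e" where
  "christoffel A g c x a b = (THE z. \<forall>w. metric_coords A g c x z w =
     (frechet_derivative (\<lambda>y. metric_coords A g c y b w) (at x) a
      + frechet_derivative (\<lambda>y. metric_coords A g c y a w) (at x) b
      - frechet_derivative (\<lambda>y. metric_coords A g c y a b) (at x) w) / 2)"

text \<open>Unit speed solutions of the geodesic equation \<open>x'' + \<Gamma>\<^sub>x(x', x') = 0\<close> on an interval \<open>I\<close>.\<close>

definition geodesic_on ::
    "('m::topological_space, 'e::euclidean_space) chart set \<Rightarrow> ('m, 'e) metric_tensor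
       \<Rightarrow> (real \<Rightarrow> 'm) \<Rightarrow> real set \<Rightarrow> bool" where
  "geodesic_on A g \<gamma> I \<longleftrightarrow> continuous_on I \<gamma> \<and>
     (\<forall>c\<in>A. \<forall>t\<in>I. \<gamma> t \<in> chart_dom c \<longrightarrow>
        (let x = chart_map c \<circ> \<gamma>; x' = (\<lambda>s. vector_derivative x (at s within I))
         in x differentiable (at t within I) \<and>
            (x' has_vector_derivative - christoffel A g c (x t) (x' t) (x' t)) (at t within I))) \<and>
     (\<forall>t\<in>I. tangent_norm g (\<gamma> t) (velocity A \<gamma> I t) = 1)"

definition ray ::
    "('m::topological_space, 'e::euclidean_space) chart set \<Rightarrow> ('m, 'e) metric_tensor
       \<Rightarrow> (real \<Rightarrow> 'm) \<Rightarrow> bool" where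
  "ray A g \<gamma> \<longleftrightarrow> geodesic_on A g \<gamma> {0..} \<and>
     (\<forall>t1\<ge>0. \<forall>t2\<ge>0. riemannian_dist A g (\<gamma> t1) (\<gamma> t2) = \<bar>t2 - t1\<bar>)"

definition busemann ::
    "('m::topological_space, 'e::euclidean_space) chart set \<Rightarrow> ('m, 'e) metric_tensor
       \<Rightarrow> (real \<Rightarrow> 'm) \<Rightarrow> 'm \<Rightarrow> real" where
  "busemann A g \<gamma> x = Lim at_top (\<lambda>t. riemannian_dist A g x (\<gamma> t) - t)"


section \<open>Viscosity solutions\<close>

text \<open>Viscosity solutions of \<open>H u = 1\<close>, where \<open>H \<phi> x\<close> depends only on the differential of \<open>\<phi>\<close>
  at \<open>x\<close>.\<close>

definition viscosity_solution ::
    "('m::topological_space, 'e::euclidean_space) chart set \<Rightarrow> (('m \<Rightarrow> real) \<Rightarrow> 'm \<Rightarrow> real)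
       \<Rightarrow> ('m \<Rightarrow> real) \<Rightarrow> bool" where
  "viscosity_solution A H u \<longleftrightarrow> continuous_on UNIV u \<and>
     (\<forall>x \<phi> N. x \<in> N \<and> C1_on A \<phi> N \<longrightarrow>
        ((\<forall>\<^sub>F y in nhds x. u y - \<phi> y \<le> u x - \<phi> x) \<longrightarrow> H \<phi> x \<le> 1) \<and>
        ((\<forall>\<^sub>F y in nhds x. u y - \<phi> y \<ge> u x - \<phi> x) \<longrightarrow> H \<phi> x \<ge> 1))"

definition viscosity_solution_gradient ::
    "('m::topological_space, 'e::euclidean_space) chart set \<Rightarrow> ('m, 'e) metric_tensor
       \<Rightarrow> ('m \<Rightarrow> real) \<Rightarrow> bool" where
  "viscosity_solution_gradient A g =
     viscosity_solution A (\<lambda>\<phi> x. tangent_norm g x (gradient A g \<phi> x))"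

definition viscosity_solution_differential ::
    "('m::topological_space, 'e::euclidean_space) chart set \<Rightarrow> ('m, 'e) metric_tensor
       \<Rightarrow> ('m \<Rightarrow> real) \<Rightarrow> bool" where
  "viscosity_solution_differential A g =
     viscosity_solution A (\<lambda>\<phi> x. (cotangent_norm A g x (differential A \<phi> x))\<^sup>2)"


section \<open>Local semi-concavity with linear modulus\<close>

definition locally_semiconcave_on :: "'e::euclidean_space set \<Rightarrow> ('e \<Rightarrow> real) \<Rightarrow> bool" where
  "locally_semiconcave_on \<Omega> u \<longleftrightarrow> continuous_on \<Omega> u \<and>
     (\<forall>\<Omega>'. open \<Omega>' \<and> convex \<Omega>' \<and> compact (closure \<Omega>') \<and> closure \<Omega>' \<subseteq> \<Omega> \<longrightarrow>
        (\<exists>C. concave_on \<Omega>' (\<lambda>x. u x - C / 2 * (norm x)\<^sup>2)))"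

definition locally_semiconcave ::
    "('m::topological_space, 'e::euclidean_space) chart set \<Rightarrow> ('m \<Rightarrow> real) \<Rightarrow> bool" where
  "locally_semiconcave A u \<longleftrightarrow> continuous_on UNIV u \<and>
     (\<forall>x. \<exists>c\<in>A. x \<in> chart_dom c \<and>
        locally_semiconcave_on (chart_map c ` chart_dom c) (u \<circ> chart_inv c))"

end

theory Submission
  imports Defs
begin

text \<open>
Two metric properties of the Busemann function \<open>b\<close> carry the whole theorem.

\<^item> \<open>nonexpansive\<close>: \<open>b\<close> drops along a curve by at most the length of the curve. This is the triangle
  inequality, passed to the limit \<open>t \<rightarrow> \<infinity>\<close>.
\<^item> \<open>steepest_descent\<close>: from every point there are curves of any prescribed length \<open>r\<close> along which
  \<open>b\<close> drops by \<open>r\<close>, up to an arbitrarily small error. Such curves are initial pieces of almost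
  shortest curves from the point to \<open>\<gamma> t\<close> for large \<open>t\<close>; the estimate survives the limit since
  \<open>d x (\<gamma> t) - t\<close> decreases in \<open>t\<close>, so that \<open>b\<close> lies below each of these functions.

\<^bold>\<open>Viscosity inequalities.\<close> Let \<open>u\<close> have both properties. In a chart, up to a factor close to
1, the length of a short curve is at least the norm of its displacement in the metric frozen at one
point, with equality for straight segments. If a test function touches \<open>u\<close> from above
at \<open>x\<close>, nonexpansiveness along the straight segments issuing from \<open>x\<close> shows that its
differential has norm at most 1 (\<open>touching_above\<close>). If it touches from below, a descent curve of
small length \<open>r\<close> is a direction in which it drops by almost \<open>r\<close>, so the norm is at least 1
(\<open>touching_below\<close>). Gradient and differential have the same norm since the metric represents
the differential by the gradient (\<open>gradient_norm\<close>), which makes the two equations equivalent.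

\<^bold>\<open>Semiconcavity.\<close> Let \<open>\<kappa>\<close> be a descent curve of fixed small length \<open>T\<close> issuing from \<open>x\<close>, in a chart.
Shifting \<open>\<kappa>\<close> by \<open>h\<close> and by \<open>- h\<close>, with a weight that decreases from 1 to 0 in proportion to the
arc length, gives curves from \<open>x + h\<close> and \<open>x - h\<close> to the same end point. Nonexpansiveness along
them, compared with the descent along \<open>\<kappa>\<close>, bounds the second difference of \<open>u\<close> at \<open>x\<close> by the second
difference of the lengths. The latter is at most \<open>C T |h|\<^sup>2\<close>: the norm of a vector is at most half of 1
plus its square, with equality for unit vectors, and the squared norm has bounded second differences
(\<open>F_second_difference\<close>, \<open>shifted_curves_length\<close>). By compactness \<open>C\<close> can be chosen
uniformly, and subtraction of a large multiple of the squared Euclidean norm then makes \<open>u\<close> concave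
(\<open>concave_on_if_locally_midpoint_concave\<close>).
\<close>

section \<open>Calculus in Euclidean space\<close>

lemma smooth_on_continuous: "smooth_on f S \<Longrightarrow> continuous_on S f"
  unfolding smooth_on_def by (metis C_k_on.simps(1))

lemma smooth_on_differentiable: "smooth_on f S \<Longrightarrow> x \<in> S \<Longrightarrow> f differentiable (at x)"
  unfolding smooth_on_def by (metis C_k_on.simps(2))

lemma smooth_on_derivative:
  "smooth_on f S \<Longrightarrow> smooth_on (\<lambda>x. frechet_derivative f (at x) v) S"
  unfolding smooth_on_def by (metis C_k_on.simps(2))

lemma linear_expand:
  fixes l :: "'a::euclidean_space \<Rightarrow> 'b::real_vector"
  assumes "linear l"
  shows "l v = (\<Sum>i\<in>Basis. (v \<bullet> i) *\<^sub>R l i)"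
proof -
  have "l v = l (\<Sum>i\<in>Basis. (v \<bullet> i) *\<^sub>R i)" by (simp add: euclidean_representation)
  also have "\<dots> = (\<Sum>i\<in>Basis. (v \<bullet> i) *\<^sub>R l i)"
    by (simp add: linear_sum[OF assms] linear_scale[OF assms])
  finally show ?thesis .
qed

lemma derivative_bounded_on_compact:
  fixes f :: "'a::euclidean_space \<Rightarrow> 'b::real_normed_vector"
  assumes f: "smooth_on f S" and K: "compact K" "K \<subseteq> S"
  obtains B where "B \<ge> 0"
    "\<And>x v. x \<in> K \<Longrightarrow> norm (frechet_derivative f (at x) v) \<le> B * norm v"
proof -
  have "\<exists>b. \<forall>x\<in>K. norm (frechet_derivative f (at x) i) \<le> b" for i
  proof -
    have "continuous_on K (\<lambda>x. frechet_derivative f (at x) i)"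
      using smooth_on_continuous[OF smooth_on_derivative[OF f]] K(2) continuous_on_subset by blast
    then have "bounded ((\<lambda>x. frechet_derivative f (at x) i) ` K)"
      using K(1) compact_continuous_image compact_imp_bounded by blast
    then show ?thesis unfolding bounded_iff by auto
  qed
  then obtain b where b: "\<And>i x. x \<in> K \<Longrightarrow> norm (frechet_derivative f (at x) i) \<le> b i"
    by metis
  have "norm (frechet_derivative f (at x) v) \<le> (\<Sum>i\<in>Basis. \<bar>b i\<bar>) * norm v" if "x \<in> K" for x v
  proof -
    have "linear (frechet_derivative f (at x))"
      using smooth_on_differentiable[OF f] K that linear_frechet_derivative by blast
    then have "frechet_derivative f (at x) v
        = (\<Sum>i\<in>Basis. (v \<bullet> i) *\<^sub>R frechet_derivative f (at x) i)"
      by (rule linear_expand)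
    also have "norm \<dots> \<le> (\<Sum>i\<in>Basis. \<bar>b i\<bar> * norm v)"
    proof (rule sum_norm_le)
      fix i :: 'a assume i: "i \<in> Basis"
      have "norm (frechet_derivative f (at x) i) \<le> \<bar>b i\<bar>" using b[OF that, of i] by linarith
      then show "norm ((v \<bullet> i) *\<^sub>R frechet_derivative f (at x) i) \<le> \<bar>b i\<bar> * norm v"
        using mult_mono[OF _ Basis_le_norm[OF i, of v]] by simp (metis abs_ge_zero mult.commute)
    qed
    finally show ?thesis by (simp add: sum_distrib_right)
  qed
  then show ?thesis using that[of "\<Sum>i\<in>Basis. \<bar>b i\<bar>"] by (simp add: sum_nonneg)
qed

lemma smooth_on_Lipschitz:
  fixes f :: "'a::euclidean_space \<Rightarrow> 'b::real_normed_vector"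
  assumes f: "smooth_on f S" and K: "compact K" "convex K" "K \<subseteq> S"
  obtains B where "B \<ge> 0" "\<And>x y. x \<in> K \<Longrightarrow> y \<in> K \<Longrightarrow> norm (f x - f y) \<le> B * norm (x - y)"
proof -
  obtain B where B: "B \<ge> 0"
    "\<And>x v. x \<in> K \<Longrightarrow> norm (frechet_derivative f (at x) v) \<le> B * norm v"
    using derivative_bounded_on_compact[OF f K(1,3)] by blast
  have "norm (f x - f y) \<le> B * norm (x - y)" if "x \<in> K" "y \<in> K" for x y
  proof (rule differentiable_bound[OF K(2)])
    fix z assume z: "z \<in> K"
    then show "(f has_derivative frechet_derivative f (at z)) (at z within K)"
      using smooth_on_differentiable[OF f] K(3) frechet_derivative_works has_derivative_at_withinI
      by blast
    show "onorm (frechet_derivative f (at z)) \<le> B"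
      using B(2)[OF z] by (rule onorm_le)
  qed (use that in auto)
  then show ?thesis using that B(1) by blast
qed

text \<open>The mean value theorem is applied to \<open>s \<mapsto> f (x + s k) + f (x - s k)\<close>, whose derivative is a
  difference of values of the Lipschitz derivative of \<open>f\<close> at two points at distance at most \<open>2 |k|\<close>.\<close>

lemma smooth_on_second_difference:
  fixes f :: "'a::euclidean_space \<Rightarrow> real"
  assumes f: "smooth_on f S" and K: "compact K" "convex K" "K \<subseteq> S"
  obtains B where "B \<ge> 0"
    "\<And>x k. x + k \<in> K \<Longrightarrow> x - k \<in> K \<Longrightarrow> \<bar>f (x + k) + f (x - k) - 2 * f x\<bar> \<le> B * (norm k)\<^sup>2"
proof -
  define D where "D x = frechet_derivative f (at x)" for x
  have "\<exists>B\<ge>0. \<forall>x\<in>K. \<forall>y\<in>K. norm (D x i - D y i) \<le> B * norm (x - y)" for i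
    using smooth_on_Lipschitz[OF smooth_on_derivative[OF f, of i] K] unfolding D_def by metis
  then obtain b where b: "\<And>i. b i \<ge> 0"
    "\<And>i x y. x \<in> K \<Longrightarrow> y \<in> K \<Longrightarrow> norm (D x i - D y i) \<le> b i * norm (x - y)"
    by metis
  have lin: "linear (D x)" if "x \<in> K" for x
    unfolding D_def using smooth_on_differentiable[OF f] K(3) that linear_frechet_derivative by blast
  have D: "\<bar>D x k - D y k\<bar> \<le> (\<Sum>i\<in>Basis. b i) * norm k * norm (x - y)"
    if "x \<in> K" "y \<in> K" for x y k
  proof -
    have "D x k - D y k = (\<Sum>i\<in>Basis. (k \<bullet> i) *\<^sub>R (D x i - D y i))"
      using linear_expand[OF lin[OF that(1)], of k] linear_expand[OF lin[OF that(2)], of k]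
      by (simp add: sum_subtractf right_diff_distrib)
    also have "\<bar>\<dots>\<bar> \<le> (\<Sum>i\<in>Basis. b i * norm k * norm (x - y))"
      unfolding real_norm_def[symmetric]
    proof (rule sum_norm_le)
      fix i :: 'a assume i: "i \<in> Basis"
      have "\<bar>k \<bullet> i\<bar> * norm (D x i - D y i) \<le> norm k * (b i * norm (x - y))"
        by (intro mult_mono Basis_le_norm[OF i] b(2) that) auto
      then show "norm ((k \<bullet> i) *\<^sub>R (D x i - D y i)) \<le> b i * norm k * norm (x - y)"
        by (simp add: abs_mult mult_ac)
    qed
    finally show ?thesis by (simp add: sum_distrib_right)
  qed
  have "\<bar>f (x + k) + f (x - k) - 2 * f x\<bar> \<le> (2 * (\<Sum>i\<in>Basis. b i)) * (norm k)\<^sup>2"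
    if xk: "x + k \<in> K" "x - k \<in> K" for x k
  proof -
    define \<psi> where "\<psi> s = f (x + s *\<^sub>R k) + f (x - s *\<^sub>R k)" for s :: real
    have inK: "x + s *\<^sub>R k \<in> K" if "\<bar>s\<bar> \<le> 1" for s
    proof -
      have "x + s *\<^sub>R k = ((1 + s) / 2) *\<^sub>R (x + k) + ((1 - s) / 2) *\<^sub>R (x - k)"
        by (rule euclidean_eqI) (simp add: inner_simps field_simps)
      also have "\<dots> \<in> K"
        by (rule convexD[OF K(2) xk]) (use that in \<open>auto simp: field_simps\<close>)
      finally show ?thesis .
    qed
    have inK': "x - s *\<^sub>R k \<in> K" if "\<bar>s\<bar> \<le> 1" for s using inK[of "- s"] that by simp
    have der: "(\<psi> has_real_derivative (D (x + s *\<^sub>R k) k - D (x - s *\<^sub>R k) k)) (at s)"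
      if "\<bar>s\<bar> \<le> 1" for s
    proof -
      have d: "(f has_derivative D y) (at y)" if "y \<in> K" for y
        unfolding D_def using smooth_on_differentiable[OF f] K(3) that frechet_derivative_works by blast
      have 1: "((\<lambda>s. f (x + s *\<^sub>R k)) has_derivative (\<lambda>r. D (x + s *\<^sub>R k) (r *\<^sub>R k))) (at s)"
        by (rule has_derivative_compose[where f = "\<lambda>s. x + s *\<^sub>R k" and f' = "\<lambda>r. r *\<^sub>R k"])
          (auto intro!: derivative_eq_intros d inK that)
      have 2: "((\<lambda>s. f (x - s *\<^sub>R k)) has_derivative (\<lambda>r. D (x - s *\<^sub>R k) (- (r *\<^sub>R k)))) (at s)"
        by (rule has_derivative_compose[where f = "\<lambda>s. x - s *\<^sub>R k" and f' = "\<lambda>r. - (r *\<^sub>R k)"])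
          (auto intro!: derivative_eq_intros d inK' that)
      have "(\<psi> has_derivative (\<lambda>r. D (x + s *\<^sub>R k) (r *\<^sub>R k) + D (x - s *\<^sub>R k) (- (r *\<^sub>R k)))) (at s)"
        unfolding \<psi>_def by (rule has_derivative_add[OF 1 2])
      then show ?thesis
        by (rule has_derivative_imp_has_field_derivative)
          (simp add: linear_scale[OF lin[OF inK[OF that]]] linear_scale[OF lin[OF inK'[OF that]]]
            linear_neg[OF lin[OF inK'[OF that]]] algebra_simps)
    qed
    obtain s :: real where s: "0 < s" "s < 1"
      "\<psi> 1 - \<psi> 0 = (1 - 0) * (D (x + s *\<^sub>R k) k - D (x - s *\<^sub>R k) k)"
      using MVT2[of 0 1 \<psi> "\<lambda>s. D (x + s *\<^sub>R k) k - D (x - s *\<^sub>R k) k"] der by auto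
    have "\<bar>\<psi> 1 - \<psi> 0\<bar> \<le> (\<Sum>i\<in>Basis. b i) * norm k * norm ((x + s *\<^sub>R k) - (x - s *\<^sub>R k))"
      using D[OF inK inK', of s s k] s by simp
    also have "(x + s *\<^sub>R k) - (x - s *\<^sub>R k) = (2 * s) *\<^sub>R k"
      by (simp add: scaleR_2 flip: scaleR_scaleR)
    also have "(\<Sum>i\<in>Basis. b i) * norm k * norm ((2 * s) *\<^sub>R k)
        \<le> (\<Sum>i\<in>Basis. b i) * norm k * (2 * norm k)"
      using s(1,2) b(1) by (intro mult_left_mono) (auto simp: sum_nonneg mult_left_le_one_le)
    finally show ?thesis by (simp add: \<psi>_def power2_eq_square mult_ac)
  qed
  then show ?thesis using that[of "2 * (\<Sum>i\<in>Basis. b i)"] b(1) by (simp add: sum_nonneg)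
qed

text \<open>At the leftmost minimum of the difference between the function and a chord, a local midpoint
  inequality is impossible unless the minimum is nonnegative.\<close>

lemma concave_on_if_locally_midpoint_concave:
  fixes f :: "'a::euclidean_space \<Rightarrow> real"
  assumes S: "convex S" "open S" and cont: "continuous_on S f"
    and mid: "\<And>x. x \<in> S \<Longrightarrow> \<exists>e>0. \<forall>h. norm h \<le> e \<longrightarrow> f (x + h) + f (x - h) \<le> 2 * f x"
  shows "concave_on S f"
proof -
  have "f (z 0) * (1 - t) + f (z 1) * t \<le> f (z t)"
    if xy: "x \<in> S" "y \<in> S" and t: "t \<in> {0..1}" and z: "z = (\<lambda>t. x + t *\<^sub>R (y - x))"
    for x y z and t :: real
  proof (rule ccontr)
    assume neg: "\<not> ?thesis"
    define \<psi> where "\<psi> r = f (z r) - (f (z 0) * (1 - r) + f (z 1) * r)" for r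
    have zS: "z r \<in> S" if "r \<in> {0..1}" for r
      using convexD_alt[OF S(1) xy, of r] that by (simp add: z algebra_simps)
    have cz: "continuous_on {0..1} \<psi>" unfolding \<psi>_def
      by (intro continuous_intros continuous_on_compose2[OF cont])
        (auto simp: z intro!: continuous_intros zS[unfolded z])
    obtain m where m: "m \<in> {0..1}" "\<And>r. r \<in> {0..1} \<Longrightarrow> \<psi> m \<le> \<psi> r"
      using continuous_attains_inf[OF compact_Icc _ cz] by auto
    define Z where "Z = {r \<in> {0..1}. \<psi> r \<in> {\<psi> m}}"
    have "closed Z" unfolding Z_def
      using continuous_closed_preimage[OF cz, of "{\<psi> m}"] by (simp add: vimage_def Int_def)
    moreover have "bounded Z" by (rule bounded_subset[of "{0..1}"]) (auto simp: Z_def)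
    ultimately have "compact Z" by (simp add: compact_eq_bounded_closed)
    then obtain l where l: "l \<in> Z" "\<And>r. r \<in> Z \<Longrightarrow> l \<le> r"
      using compact_attains_inf[of Z] m(1) by (auto simp: Z_def)
    have mneg: "\<psi> l < 0" using m(2)[OF t] neg l(1) by (simp add: \<psi>_def Z_def)
    have "l \<noteq> 0" "l \<noteq> 1" using mneg by (auto simp: \<psi>_def)
    then have l01: "0 < l" "l < 1" using l(1) by (auto simp: Z_def)
    obtain e where e: "e > 0" "\<And>h. norm h \<le> e \<Longrightarrow> f (z l + h) + f (z l - h) \<le> 2 * f (z l)"
      using mid[OF zS, of l] l01 by auto
    define s where "s = min (min l (1 - l)) (e / (norm (y - x) + 1))"
    have s: "0 < s" "s \<le> l" "s \<le> 1 - l" "s \<le> e / (norm (y - x) + 1)"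
      using l01 e(1) by (auto simp: s_def add_nonneg_pos)
    have "s * norm (y - x) \<le> s * (norm (y - x) + 1)" using s(1) by simp
    also have "\<dots> \<le> e" using s(4) by (simp add: pos_le_divide_eq add_nonneg_pos)
    finally have "norm (s *\<^sub>R (y - x)) \<le> e" using s(1) by simp
    from e(2)[OF this] have "f (z (l + s)) + f (z (l - s)) \<le> 2 * f (z l)"
      by (simp add: z algebra_simps)
    then have "\<psi> (l + s) + \<psi> (l - s) \<le> 2 * \<psi> l" by (simp add: \<psi>_def algebra_simps)
    moreover have "\<psi> l \<le> \<psi> (l + s)" using m(2)[of "l + s"] s l(1) by (auto simp: Z_def)
    moreover have "\<psi> l < \<psi> (l - s)"
    proof -
      have "\<psi> m \<le> \<psi> (l - s)" using m(2)[of "l - s"] s l01 by auto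
      moreover have "\<psi> (l - s) \<noteq> \<psi> m" using l(2)[of "l - s"] s l01 by (auto simp: Z_def)
      ultimately show ?thesis using l(1) by (auto simp: Z_def)
    qed
    ultimately show False by linarith
  qed
  then have main: "f x * (1 - t) + f y * t \<le> f (x + t *\<^sub>R (y - x))"
    if "x \<in> S" "y \<in> S" "t \<in> {0..1}" for x y t
    using that by fastforce
  show ?thesis unfolding concave_on_def
  proof (rule convex_onI[OF _ S(1)])
    fix t :: real and x y assume "0 < t" "t < 1" "x \<in> S" "y \<in> S"
    then show "- f ((1 - t) *\<^sub>R x + t *\<^sub>R y) \<le> (1 - t) * - f x + t * - f y"
      using main[of x y t] by (simp add: algebra_simps)
  qed
qed

lemma le_if_le_add_epsilon_mult:
  fixes x y k :: real
  assumes "\<And>e. 0 < e \<Longrightarrow> e < 1 \<Longrightarrow> x \<le> y + e * k"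
  shows "x \<le> y"
proof (rule field_le_epsilon)
  fix e :: real assume e: "e > 0"
  define d where "d = min (1 / 2) (e / (\<bar>k\<bar> + 1))"
  have d: "0 < d" "d < 1" "d \<le> e / (\<bar>k\<bar> + 1)" using e by (auto simp: d_def)
  have "d * k \<le> d * (\<bar>k\<bar> + 1)" using d(1) by (intro mult_left_mono) auto
  also have "\<dots> \<le> e" using d(3) by (simp add: pos_le_divide_eq add_nonneg_pos)
  finally show "x \<le> y + e" using assms[OF d(1,2)] by simp
qed

section \<open>Charts and tangent vectors\<close>

abbreviation chart_range :: "('m, 'e) chart \<Rightarrow> 'e set" where
  "chart_range c \<equiv> chart_map c ` chart_dom c"

locale smooth_manifold =
  fixes A :: "('m::{t2_space, second_countable_topology}, 'e::euclidean_space) chart set"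
  assumes smooth: "smooth_structure A"
begin

lemma chart: "c \<in> A \<Longrightarrow> is_chart c"
  using smooth unfolding smooth_structure_def by blast

lemma open_chart_dom: "c \<in> A \<Longrightarrow> open (chart_dom c)"
  using chart unfolding is_chart_def by blast

lemma open_chart_range: "c \<in> A \<Longrightarrow> open (chart_range c)"
  using chart unfolding is_chart_def by blast

lemma chart_homeomorphism:
  "c \<in> A \<Longrightarrow> homeomorphism (chart_dom c) (chart_range c) (chart_map c) (chart_inv c)"
  using chart unfolding is_chart_def by blast

lemma chart_inv_map [simp]: "c \<in> A \<Longrightarrow> p \<in> chart_dom c \<Longrightarrow> chart_inv c (chart_map c p) = p"
  using chart_homeomorphism unfolding homeomorphism_def by blast

lemma chart_map_inv [simp]: "c \<in> A \<Longrightarrow> x \<in> chart_range c \<Longrightarrow> chart_map c (chart_inv c x) = x"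
  using chart_homeomorphism[of c] unfolding homeomorphism_def by blast

lemma chart_inv_in_dom: "c \<in> A \<Longrightarrow> x \<in> chart_range c \<Longrightarrow> chart_inv c x \<in> chart_dom c"
  using chart_inv_map by force

lemma continuous_on_chart_map: "c \<in> A \<Longrightarrow> continuous_on (chart_dom c) (chart_map c)"
  using chart_homeomorphism unfolding homeomorphism_def by blast

lemma continuous_on_chart_inv: "c \<in> A \<Longrightarrow> continuous_on (chart_range c) (chart_inv c)"
  using chart_homeomorphism unfolding homeomorphism_def by blast

lemma charts_at_iff: "c \<in> charts_at A p \<longleftrightarrow> c \<in> A \<and> p \<in> chart_dom c"
  unfolding charts_at_def by blast

lemma exists_chart: "\<exists>c. c \<in> charts_at A p"
  using smooth unfolding smooth_structure_def charts_at_def by blast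

lemma chart_inv_image_eq:
  assumes "c \<in> A" "W \<subseteq> chart_range c"
  shows "chart_inv c ` W = chart_dom c \<inter> chart_map c -` W"
proof -
  have "p \<in> chart_inv c ` W" if "p \<in> chart_dom c" "chart_map c p \<in> W" for p
    using that assms(1) by (metis chart_inv_map image_eqI)
  moreover have "chart_inv c x \<in> chart_dom c \<and> chart_map c (chart_inv c x) \<in> W" if "x \<in> W" for x
    using that assms chart_inv_in_dom chart_map_inv by (metis subsetD)
  ultimately show ?thesis by blast
qed

lemma open_chart_inv_image:
  assumes "c \<in> A" "open W" "W \<subseteq> chart_range c"
  shows "open (chart_inv c ` W)"
  unfolding chart_inv_image_eq[OF assms(1,3)]
  using continuous_on_open_vimage[OF open_chart_dom[OF assms(1)]]
    continuous_on_chart_map[OF assms(1)] assms(2) by (metis Int_commute)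

abbreviation transition :: "('m, 'e) chart \<Rightarrow> ('m, 'e) chart \<Rightarrow> 'e \<Rightarrow> 'e" where
  "transition c c' \<equiv> chart_map c' \<circ> chart_inv c"

abbreviation overlap :: "('m, 'e) chart \<Rightarrow> 'm set \<Rightarrow> 'e set" where
  "overlap c N \<equiv> chart_map c ` (N \<inter> chart_dom c)"

lemma overlap_eq:
  assumes "c \<in> A" shows "overlap c N = chart_range c \<inter> chart_inv c -` N"
  using chart_inv_map[OF assms] by (auto simp: image_iff)

lemma open_overlap:
  assumes "c \<in> A" "open N" shows "open (overlap c N)"
  unfolding overlap_eq[OF assms(1)]
  using continuous_on_open_vimage[OF open_chart_range[OF assms(1)]]
    continuous_on_chart_inv[OF assms(1)] assms(2) by (metis Int_commute)

lemma smooth_transition: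
  assumes "c \<in> A" "c' \<in> A"
  shows "smooth_on (transition c c') (overlap c (chart_dom c'))"
  using smooth assms unfolding smooth_structure_def smoothly_compatible_def
  by (metis Int_commute)

abbreviation jacobian :: "('m, 'e) chart \<Rightarrow> ('m, 'e) chart \<Rightarrow> 'm \<Rightarrow> 'e \<Rightarrow> 'e" where
  "jacobian c c' p \<equiv> frechet_derivative (transition c c') (at (chart_map c p))"

lemma transition_has_derivative:
  assumes "c \<in> charts_at A p" "c' \<in> charts_at A p"
  shows "(transition c c' has_derivative jacobian c c' p) (at (chart_map c p))"
  using smooth_on_differentiable[OF smooth_transition[of c c'], of "chart_map c p"] assms
  unfolding charts_at_iff frechet_derivative_works[symmetric] by blast

lemma linear_jacobian:
  assumes "c \<in> charts_at A p" "c' \<in> charts_at A p"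
  shows "linear (jacobian c c' p)"
  using has_derivative_linear transition_has_derivative[OF assms] by blast

lemma jacobian_self:
  assumes "c \<in> charts_at A p" shows "jacobian c c p a = a"
proof -
  have c: "c \<in> A" "p \<in> chart_dom c" using assms by (auto simp: charts_at_iff)
  have "((\<lambda>x. x) has_derivative jacobian c c p) (at (chart_map c p))"
    by (rule has_derivative_transform_within_open[OF transition_has_derivative[OF assms assms]
          open_chart_range[OF c(1)]]) (use c in auto)
  then show ?thesis using has_derivative_unique[OF has_derivative_ident] by metis
qed

lemma jacobian_chain:
  assumes "c \<in> charts_at A p" "c' \<in> charts_at A p" "c'' \<in> charts_at A p"
  shows "jacobian c' c'' p (jacobian c c' p a) = jacobian c c'' p a"
proof -
  have c: "c \<in> A" "p \<in> chart_dom c" "c' \<in> A" "p \<in> chart_dom c'"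
    using assms by (auto simp: charts_at_iff)
  have "transition c c' (chart_map c p) = chart_map c' p" using c by simp
  then have "(transition c' c'' \<circ> transition c c' has_derivative jacobian c' c'' p \<circ> jacobian c c' p)
      (at (chart_map c p))"
    using diff_chain_at[OF transition_has_derivative[OF assms(1,2)], of "transition c' c''"]
      transition_has_derivative[OF assms(2,3)] by simp
  then have "(transition c c'' has_derivative jacobian c' c'' p \<circ> jacobian c c' p) (at (chart_map c p))"
    by (rule has_derivative_transform_within_open[OF _ open_overlap[OF c(1) open_chart_dom[OF c(3)]]])
      (use c in auto)
  then show ?thesis
    using has_derivative_unique[OF transition_has_derivative[OF assms(1,3)]] by (metis comp_apply)
qed

lemma coord_vec_in_tangent_space:
  "c \<in> charts_at A p \<Longrightarrow> coord_vec A c p a \<in> tangent_space A p"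
  unfolding tangent_space_def coord_vec_def by (auto simp: jacobian_chain)

lemma coord_vec_self: "c \<in> charts_at A p \<Longrightarrow> coord_vec A c p a c = a"
  unfolding coord_vec_def by (simp add: jacobian_self)

lemma coord_vec_component:
  assumes "c \<in> charts_at A p" "v \<in> tangent_space A p" shows "coord_vec A c p (v c) = v"
proof (rule ext)
  fix c'
  show "coord_vec A c p (v c) c' = v c'"
  proof (cases "c' \<in> charts_at A p")
    case True
    then have "v c' = jacobian c c' p (v c)" using assms unfolding tangent_space_def by blast
    then show ?thesis using True by (simp only: coord_vec_def if_True)
  next
    case False
    then have "v c' = 0" using assms(2) unfolding tangent_space_def by blast
    then show ?thesis using False by (simp only: coord_vec_def if_False)
  qed
qed

lemma coord_vec_combination:
  assumes "c \<in> charts_at A p"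
  shows "coord_vec A c p (r *\<^sub>R a + s *\<^sub>R b) =
    (\<lambda>c'. r *\<^sub>R coord_vec A c p a c' + s *\<^sub>R coord_vec A c p b c')"
  unfolding coord_vec_def
  by (rule ext) (simp add: linear_add[OF linear_jacobian] linear_scale[OF linear_jacobian] assms)

end

section \<open>The metric in a chart\<close>

locale riemannian = smooth_manifold A
  for A :: "('m::{t2_space, second_countable_topology}, 'e::euclidean_space) chart set" +
  fixes g :: "('m, 'e) metric_tensor"
  assumes metric: "riemannian_metric A g"
begin

abbreviation G :: "('m, 'e) chart \<Rightarrow> 'e \<Rightarrow> 'e \<Rightarrow> 'e \<Rightarrow> real" where
  "G \<equiv> metric_coords A g"

text \<open>The norm of the tangent vector with components \<open>v\<close> at the point with coordinates \<open>x\<close>.\<close>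

definition F :: "('m, 'e) chart \<Rightarrow> 'e \<Rightarrow> 'e \<Rightarrow> real" where
  "F c x v = sqrt (G c x v v)"

lemma chart_inv_charts_at: "c \<in> A \<Longrightarrow> x \<in> chart_range c \<Longrightarrow> c \<in> charts_at A (chart_inv c x)"
  by (simp add: charts_at_iff chart_inv_in_dom)

lemma G_commute:
  assumes "c \<in> A" "x \<in> chart_range c" shows "G c x a b = G c x b a"
  using metric coord_vec_in_tangent_space[OF chart_inv_charts_at[OF assms]]
  unfolding riemannian_metric_def metric_coords_def by blast

lemma G_combination_left:
  assumes "c \<in> A" "x \<in> chart_range c"
  shows "G c x (r *\<^sub>R a + s *\<^sub>R b) w = r * G c x a w + s * G c x b w"
  using metric coord_vec_in_tangent_space[OF chart_inv_charts_at[OF assms]]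
  unfolding riemannian_metric_def metric_coords_def
    coord_vec_combination[OF chart_inv_charts_at[OF assms]] by blast

lemma bilinear_G:
  assumes "c \<in> A" "x \<in> chart_range c" shows "bilinear (G c x)"
proof -
  have "linear (\<lambda>a. G c x a w)" for w
    using G_combination_left[OF assms, of 1 _ 1 _ w] G_combination_left[OF assms, of _ _ 0 0 w]
    by (intro linearI) auto
  moreover have "linear (G c x w)" for w
    using calculation[of w] G_commute[OF assms] by presburger
  ultimately show ?thesis unfolding bilinear_def by blast
qed

lemma G_pos:
  assumes "c \<in> A" "x \<in> chart_range c" "v \<noteq> 0" shows "G c x v v > 0"
proof -
  note cp = chart_inv_charts_at[OF assms(1,2)]
  have "coord_vec A c (chart_inv c x) v \<noteq> (\<lambda>c. 0)"
    using coord_vec_self[OF cp, of v] assms(3) by metis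
  then show ?thesis
    using metric coord_vec_in_tangent_space[OF cp]
    unfolding riemannian_metric_def metric_coords_def by blast
qed

lemma G_nonneg: "c \<in> A \<Longrightarrow> x \<in> chart_range c \<Longrightarrow> 0 \<le> G c x v v"
  using G_pos[of c x v] bilinear_lzero[OF bilinear_G[of c x]] by (cases "v = 0") auto

lemma F_nonneg: "c \<in> A \<Longrightarrow> x \<in> chart_range c \<Longrightarrow> 0 \<le> F c x v"
  by (simp add: F_def G_nonneg)

lemma F_power2: "c \<in> A \<Longrightarrow> x \<in> chart_range c \<Longrightarrow> (F c x v)\<^sup>2 = G c x v v"
  by (simp add: F_def G_nonneg)

lemma F_scaleR:
  assumes "c \<in> A" "x \<in> chart_range c" shows "F c x (r *\<^sub>R v) = \<bar>r\<bar> * F c x v"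
  using bilinear_lmul[OF bilinear_G[OF assms]] bilinear_rmul[OF bilinear_G[OF assms]]
  by (simp add: F_def real_sqrt_mult flip: mult.assoc)

lemma F_zero: "c \<in> A \<Longrightarrow> x \<in> chart_range c \<Longrightarrow> F c x 0 = 0"
  using F_scaleR[of c x 0] by simp

lemma G_Cauchy_Schwarz:
  assumes "c \<in> A" "x \<in> chart_range c" shows "\<bar>G c x a b\<bar> \<le> F c x a * F c x b"
proof (cases "b = 0")
  case True
  then show ?thesis using bilinear_rzero[OF bilinear_G[OF assms]] F_zero[OF assms] by simp
next
  case False
  note bil = bilinear_G[OF assms]
  define t where "t = G c x a b / G c x b b"
  have b: "G c x b b > 0" by (rule G_pos[OF assms False])
  have "0 \<le> G c x (a - t *\<^sub>R b) (a - t *\<^sub>R b)" by (rule G_nonneg[OF assms])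
  also have "\<dots> = G c x a a - 2 * t * G c x a b + t\<^sup>2 * G c x b b"
    using G_commute[OF assms, of b a]
    by (simp add: bilinear_lsub[OF bil] bilinear_rsub[OF bil] bilinear_lmul[OF bil]
        bilinear_rmul[OF bil] power2_eq_square algebra_simps)
  also have "\<dots> = G c x a a - (G c x a b)\<^sup>2 / G c x b b"
    using b by (simp add: t_def power2_eq_square)
  finally have "(G c x a b)\<^sup>2 \<le> G c x a a * G c x b b" using b by (simp add: field_simps)
  also have "\<dots> = (F c x a * F c x b)\<^sup>2" by (simp add: power_mult_distrib F_power2[OF assms])
  finally show ?thesis
    using F_nonneg[OF assms] by (metis abs_le_square_iff abs_of_nonneg mult_nonneg_nonneg)
qed

lemma G_expand:
  assumes "c \<in> A" "x \<in> chart_range c"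
  shows "G c x a b = (\<Sum>i\<in>Basis. \<Sum>j\<in>Basis. (a \<bullet> i) * (b \<bullet> j) * G c x i j)"
proof -
  have "G c x a b = (\<Sum>i\<in>Basis. (a \<bullet> i) * G c x i b)"
    using linear_expand[of "\<lambda>a. G c x a b" a] bilinear_G[OF assms] unfolding bilinear_def by simp
  also have "\<dots> = (\<Sum>i\<in>Basis. (a \<bullet> i) * (\<Sum>j\<in>Basis. (b \<bullet> j) * G c x i j))"
    using linear_expand[of "G c x _" b] bilinear_G[OF assms] unfolding bilinear_def by simp
  finally show ?thesis by (simp add: sum_distrib_left mult_ac)
qed

lemma smooth_on_G: "c \<in> A \<Longrightarrow> smooth_on (\<lambda>x. G c x a b) (chart_range c)"
  using metric unfolding riemannian_metric_def by blast

lemma continuous_on_G: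
  assumes "c \<in> A" "continuous_on S x" "continuous_on S a" "continuous_on S b"
    "x ` S \<subseteq> chart_range c"
  shows "continuous_on S (\<lambda>t. G c (x t) (a t) (b t))"
proof (rule continuous_on_eq)
  have "continuous_on S (\<lambda>t. G c (x t) i j)" for i j
    using continuous_on_compose2[OF smooth_on_continuous[OF smooth_on_G[OF assms(1)]] assms(2,5)] .
  then show "continuous_on S
      (\<lambda>t. \<Sum>i\<in>Basis. \<Sum>j\<in>Basis. (a t \<bullet> i) * (b t \<bullet> j) * G c (x t) i j)"
    using assms(3,4) by (intro continuous_intros)
  fix t assume "t \<in> S"
  then have "x t \<in> chart_range c" using assms(5) by blast
  then show "(\<Sum>i\<in>Basis. \<Sum>j\<in>Basis. (a t \<bullet> i) * (b t \<bullet> j) * G c (x t) i j) = G c (x t) (a t) (b t)"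
    by (rule G_expand[OF assms(1), symmetric])
qed

lemma continuous_on_F:
  assumes "c \<in> A" "continuous_on S x" "continuous_on S v" "x ` S \<subseteq> chart_range c"
  shows "continuous_on S (\<lambda>t. F c (x t) (v t))"
  unfolding F_def by (intro continuous_intros continuous_on_G assms)

text \<open>The uniform estimates on a set \<open>K\<close> of coordinates that the local arguments consume: comparison of
  the metric with the Euclidean norm, and bounds for its first and second differences.\<close>

definition controlled :: "('m, 'e) chart \<Rightarrow> 'e set \<Rightarrow> real \<Rightarrow> real \<Rightarrow> real \<Rightarrow> bool" where
  "controlled c K l L B \<longleftrightarrow> c \<in> A \<and> K \<subseteq> chart_range c \<and> 0 < l \<and> 0 < L \<and> 0 \<le> B \<and>
     (\<forall>x\<in>K. \<forall>v. l * norm v \<le> F c x v \<and> F c x v \<le> L * norm v) \<and>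
     (\<forall>x\<in>K. \<forall>y\<in>K. \<forall>a b. \<bar>G c x a b - G c y a b\<bar> \<le> B * norm (x - y) * norm a * norm b) \<and>
     (\<forall>x k v. x + k \<in> K \<longrightarrow> x - k \<in> K \<longrightarrow> x \<in> K \<longrightarrow>
        \<bar>G c (x + k) v v + G c (x - k) v v - 2 * G c x v v\<bar> \<le> B * (norm k)\<^sup>2 * (norm v)\<^sup>2)"

lemma abs_double_sum_le:
  fixes a b :: 'e and t :: "'e \<Rightarrow> 'e \<Rightarrow> real"
  assumes "\<And>i j. i \<in> Basis \<Longrightarrow> j \<in> Basis \<Longrightarrow> \<bar>t i j\<bar> \<le> T i j * r"
  shows "\<bar>\<Sum>i\<in>Basis. \<Sum>j\<in>Basis. (a \<bullet> i) * (b \<bullet> j) * t i j\<bar>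
    \<le> (\<Sum>i\<in>Basis. \<Sum>j\<in>Basis. T i j) * r * norm a * norm b"
proof -
  have "\<bar>\<Sum>i\<in>Basis. \<Sum>j\<in>Basis. (a \<bullet> i) * (b \<bullet> j) * t i j\<bar>
      \<le> (\<Sum>i\<in>Basis. \<Sum>j\<in>Basis. norm a * norm b * (T i j * r))"
  proof (intro order_trans[OF sum_abs] sum_mono)
    fix i j :: 'e assume ij: "i \<in> Basis" "j \<in> Basis"
    show "\<bar>(a \<bullet> i) * (b \<bullet> j) * t i j\<bar> \<le> norm a * norm b * (T i j * r)"
      unfolding abs_mult using ij assms
      by (intro mult_mono Basis_le_norm) auto
  qed
  then show ?thesis by (simp add: sum_distrib_left sum_distrib_right mult_ac)
qed

text \<open>By bilinearity each estimate reduces to the finitely many coefficients of the metric on basis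
  vectors; the lower bound is the minimum of the norm on the compact set of Euclidean unit vectors
  over \<open>K\<close>.\<close>

lemma exists_controlled:
  assumes c: "c \<in> A" and K: "compact K" "convex K" "K \<subseteq> chart_range c"
  obtains l L B where "controlled c K l L B"
proof -
  have in_range: "x \<in> chart_range c" if "x \<in> K" for x using that K(3) by blast
  obtain l where l: "l > 0" "\<And>x v. x \<in> K \<Longrightarrow> l * norm v \<le> F c x v"
  proof (cases "K = {}")
    case True
    then show ?thesis using that[of 1] by simp
  next
    case False
    let ?S = "K \<times> sphere (0::'e) 1"
    have "continuous_on ?S (\<lambda>z. F c (fst z) (snd z))"
      using K(3) by (intro continuous_on_F continuous_intros c) auto
    moreover have "compact ?S" "?S \<noteq> {}" using K(1) False by (auto simp: compact_Times)
    ultimately obtain z where z: "z \<in> ?S" "\<And>y. y \<in> ?S \<Longrightarrow> F c (fst z) (snd z) \<le> F c (fst y) (snd y)"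
      using continuous_attains_inf[of ?S "\<lambda>z. F c (fst z) (snd z)"] by blast
    have "snd z \<noteq> 0" "fst z \<in> chart_range c" using z(1) in_range by auto
    then have "F c (fst z) (snd z) > 0" using G_pos[OF c] by (simp add: F_def)
    moreover have "F c (fst z) (snd z) * norm v \<le> F c x v" if "x \<in> K" for x v
    proof (cases "v = 0")
      case True
      then show ?thesis using F_zero[OF c in_range[OF that]] by simp
    next
      case False
      have "F c (fst z) (snd z) \<le> F c x ((1 / norm v) *\<^sub>R v)"
        using z(2)[of "(x, (1 / norm v) *\<^sub>R v)"] that False by simp
      then show ?thesis using False F_scaleR[OF c in_range[OF that]] by (simp add: field_simps)
    qed
    ultimately show ?thesis using that by blast
  qed
  have "\<exists>T. \<forall>x\<in>K. \<bar>G c x i j\<bar> \<le> T" for i j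
  proof -
    have "continuous_on K (\<lambda>x. G c x i j)"
      using smooth_on_continuous[OF smooth_on_G[OF c]] K(3) continuous_on_subset by blast
    then have "bounded ((\<lambda>x. G c x i j) ` K)"
      using K(1) compact_continuous_image compact_imp_bounded by blast
    then show ?thesis unfolding bounded_iff by auto
  qed
  then obtain T where T: "\<And>i j x. x \<in> K \<Longrightarrow> \<bar>G c x i j\<bar> \<le> T i j" by metis
  define L where "L = \<bar>\<Sum>i\<in>Basis. \<Sum>j\<in>Basis. T i j\<bar> + 1"
  have L: "F c x v \<le> L * norm v" if "x \<in> K" for x v
  proof -
    have "G c x v v \<le> \<bar>G c x v v\<bar>" by simp
    also have "\<dots> \<le> (\<Sum>i\<in>Basis. \<Sum>j\<in>Basis. T i j) * 1 * norm v * norm v"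
      unfolding G_expand[OF c in_range[OF that], of v v] using T[OF that]
      by (intro abs_double_sum_le) auto
    also have "\<dots> \<le> L * 1 * norm v * norm v" unfolding L_def by (intro mult_right_mono) auto
    also have "\<dots> \<le> (L * norm v)\<^sup>2"
    proof -
      have "L * 1 \<le> L * L" unfolding L_def by (intro mult_left_mono) auto
      then have "L * 1 * (norm v * norm v) \<le> L * L * (norm v * norm v)" by (rule mult_right_mono) auto
      then show ?thesis by (simp add: power2_eq_square mult_ac)
    qed
    finally show ?thesis unfolding F_def by (rule real_le_lsqrt[rotated 1]) (auto simp: L_def)
  qed
  have "\<exists>b\<ge>0. \<forall>x\<in>K. \<forall>y\<in>K. \<bar>G c x i j - G c y i j\<bar> \<le> b * norm (x - y)" for i j
    using smooth_on_Lipschitz[OF smooth_on_G[OF c] K, of i j] unfolding real_norm_def by metis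
  then obtain B1 where B1: "\<And>i j. B1 i j \<ge> 0"
    "\<And>i j x y. x \<in> K \<Longrightarrow> y \<in> K \<Longrightarrow> \<bar>G c x i j - G c y i j\<bar> \<le> B1 i j * norm (x - y)"
    by metis
  have "\<exists>b\<ge>0. \<forall>x k. x + k \<in> K \<longrightarrow> x - k \<in> K \<longrightarrow>
      \<bar>G c (x + k) i j + G c (x - k) i j - 2 * G c x i j\<bar> \<le> b * (norm k)\<^sup>2" for i j
    using smooth_on_second_difference[OF smooth_on_G[OF c] K, of i j] by metis
  then obtain B2 where B2: "\<And>i j. B2 i j \<ge> 0"
    "\<And>i j x k. x + k \<in> K \<Longrightarrow> x - k \<in> K \<Longrightarrow>
      \<bar>G c (x + k) i j + G c (x - k) i j - 2 * G c x i j\<bar> \<le> B2 i j * (norm k)\<^sup>2"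
    by metis
  define b1 where "b1 = (\<Sum>i\<in>Basis. \<Sum>j\<in>Basis. B1 i j)"
  define b2 where "b2 = (\<Sum>i\<in>Basis. \<Sum>j\<in>Basis. B2 i j)"
  have b: "0 \<le> b1" "0 \<le> b2" unfolding b1_def b2_def using B1(1) B2(1) by (auto intro!: sum_nonneg)
  have 1: "\<bar>G c x v w - G c y v w\<bar> \<le> b1 * norm (x - y) * norm v * norm w"
    if "x \<in> K" "y \<in> K" for x y v w
  proof -
    have "G c x v w - G c y v w
        = (\<Sum>i\<in>Basis. \<Sum>j\<in>Basis. (v \<bullet> i) * (w \<bullet> j) * (G c x i j - G c y i j))"
      unfolding G_expand[OF c in_range[OF that(1)], of v w] G_expand[OF c in_range[OF that(2)], of v w]
      by (simp add: sum_subtractf right_diff_distrib)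
    then show ?thesis unfolding b1_def using B1(2)[OF that] by (simp add: abs_double_sum_le)
  qed
  have 2: "\<bar>G c (x + k) v v + G c (x - k) v v - 2 * G c x v v\<bar> \<le> b2 * (norm k)\<^sup>2 * (norm v)\<^sup>2"
    if "x + k \<in> K" "x - k \<in> K" "x \<in> K" for x k v
  proof -
    have "G c (x + k) v v + G c (x - k) v v - 2 * G c x v v
        = (\<Sum>i\<in>Basis. \<Sum>j\<in>Basis. (v \<bullet> i) * (v \<bullet> j) *
            (G c (x + k) i j + G c (x - k) i j - 2 * G c x i j))"
      unfolding G_expand[OF c in_range[OF that(1)], of v v] G_expand[OF c in_range[OF that(2)], of v v]
        G_expand[OF c in_range[OF that(3)], of v v]
      by (simp add: sum_subtractf sum.distrib sum_distrib_left distrib_left right_diff_distrib mult_ac)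
    then have "\<bar>G c (x + k) v v + G c (x - k) v v - 2 * G c x v v\<bar>
        \<le> b2 * (norm k)\<^sup>2 * norm v * norm v"
      unfolding b2_def using B2(2)[OF that(1,2)] by (simp add: abs_double_sum_le)
    then show ?thesis by (simp add: power2_eq_square mult_ac)
  qed
  have "controlled c K l L (b1 + b2)"
    unfolding controlled_def
  proof (intro conjI ballI allI impI)
    show "\<bar>G c x v w - G c y v w\<bar> \<le> (b1 + b2) * norm (x - y) * norm v * norm w"
      if "x \<in> K" "y \<in> K" for x y v w
      by (rule order_trans[OF 1[OF that]]) (intro mult_right_mono; simp add: b)
    show "\<bar>G c (x + k) v v + G c (x - k) v v - 2 * G c x v v\<bar> \<le> (b1 + b2) * (norm k)\<^sup>2 * (norm v)\<^sup>2"
      if "x + k \<in> K" "x - k \<in> K" "x \<in> K" for x k v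
      by (rule order_trans[OF 2[OF that]]) (intro mult_right_mono; simp add: b)
  qed (use c K(3) l L b in \<open>auto simp: L_def\<close>)
  then show ?thesis using that by blast
qed

lemma controlledD:
  assumes "controlled c K l L B"
  shows "c \<in> A" "K \<subseteq> chart_range c" "0 < l" "0 < L" "0 \<le> B"
    "x \<in> K \<Longrightarrow> l * norm v \<le> F c x v" "x \<in> K \<Longrightarrow> F c x v \<le> L * norm v"
    "x \<in> K \<Longrightarrow> y \<in> K \<Longrightarrow> \<bar>G c x a b - G c y a b\<bar> \<le> B * norm (x - y) * norm a * norm b"
    "x + k \<in> K \<Longrightarrow> x - k \<in> K \<Longrightarrow> x \<in> K \<Longrightarrow>
        \<bar>G c (x + k) v v + G c (x - k) v v - 2 * G c x v v\<bar> \<le> B * (norm k)\<^sup>2 * (norm v)\<^sup>2"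
  using assms by (simp_all add: controlled_def)

lemma F_compare:
  assumes K: "controlled c K l L B" and xy: "x \<in> K" "y \<in> K"
  shows "F c x v \<le> (1 + B / l\<^sup>2 * norm (x - y)) * F c y v"
proof -
  note D = controlledD[OF K]
  have r: "x \<in> chart_range c" "y \<in> chart_range c" using D(2) xy by auto
  let ?q = "B / l\<^sup>2 * norm (x - y)"
  have q: "0 \<le> ?q" using D(5) by simp
  have "G c x v v \<le> G c y v v + B * norm (x - y) * (norm v)\<^sup>2"
    using D(8)[OF xy, of v v] by (simp add: power2_eq_square mult_ac)
  also have "B * norm (x - y) * (norm v)\<^sup>2 = ?q * (l * norm v)\<^sup>2"
    using D(3) by (simp add: power_mult_distrib)
  also have "\<dots> \<le> ?q * (F c y v)\<^sup>2"
    using D(3,6) xy(2) q by (intro mult_left_mono power_mono) auto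
  finally have "(F c x v)\<^sup>2 \<le> (1 + ?q) * (F c y v)\<^sup>2"
    by (simp add: F_power2 D(1) r distrib_right)
  also have "\<dots> \<le> (1 + ?q)\<^sup>2 * (F c y v)\<^sup>2"
    using q by (intro mult_right_mono) (auto simp: power2_eq_square)
  also have "\<dots> = ((1 + ?q) * F c y v)\<^sup>2" by (simp add: power_mult_distrib)
  finally show ?thesis
  proof (rule power2_le_imp_le)
    show "0 \<le> (1 + ?q) * F c y v" by (intro mult_nonneg_nonneg add_nonneg_nonneg q F_nonneg D(1) r(2)) simp
  qed
qed

text \<open>By homogeneity in \<open>v\<close> it suffices to take a unit vector. For it the estimate \<open>F \<le> (1 + F\<^sup>2) / 2\<close> is an
  equality at the middle point, and \<open>F\<^sup>2\<close> is a smooth quadratic form, whose second difference is of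
  order \<open>|h|\<^sup>2\<close>. The velocity is perturbed in proportion to \<open>F c x v\<close>, which keeps the statement
  homogeneous and makes it meaningful also where the velocity of a curve vanishes.\<close>

lemma F_second_difference:
  assumes K: "controlled c K l L B" and \<beta>: "0 \<le> \<beta>" and \<alpha>: "0 \<le> \<alpha>" "\<alpha> \<le> 1"
    and x: "x \<in> K" "x + \<alpha> *\<^sub>R h \<in> K" "x - \<alpha> *\<^sub>R h \<in> K"
  defines "C \<equiv> (B / l\<^sup>2 + 4 * \<beta> * B / l + 2 * \<beta>\<^sup>2 * L\<^sup>2) / 2"
  shows "F c (x + \<alpha> *\<^sub>R h) (v - (F c x v * \<beta>) *\<^sub>R h) + F c (x - \<alpha> *\<^sub>R h) (v + (F c x v * \<beta>) *\<^sub>R h)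
    \<le> F c x v * (2 + C * (norm h)\<^sup>2)"
proof -
  note D = controlledD[OF K]
  have rng: "y \<in> K \<Longrightarrow> y \<in> chart_range c" for y using D(2) by blast
  have sqrt_le: "2 * F c y w \<le> 1 + G c y w w" if "y \<in> K" for y w
    using F_power2[OF D(1) rng[OF that], of w] zero_le_power2[of "F c y w - 1"]
    by (simp add: power2_eq_square algebra_simps)
  let ?k = "\<alpha> *\<^sub>R h"
  have unit: "F c (x + ?k) (w - \<beta> *\<^sub>R h) + F c (x - ?k) (w + \<beta> *\<^sub>R h) \<le> 2 + C * (norm h)\<^sup>2"
    if w: "F c x w = 1" for w
  proof -
    note bil = bilinear_G[OF D(1) rng]
    have nk: "norm ?k \<le> norm h" using \<alpha> by (simp add: mult_left_le_one_le)
    have nw: "norm w \<le> 1 / l" using D(6)[OF x(1), of w] w D(3) by (simp add: field_simps)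
    have e1: "G c (x + ?k) (w - \<beta> *\<^sub>R h) (w - \<beta> *\<^sub>R h)
        = G c (x + ?k) w w - 2 * \<beta> * G c (x + ?k) w h + \<beta>\<^sup>2 * G c (x + ?k) h h"
      using G_commute[OF D(1) rng[OF x(2)], of h w]
      by (simp add: bilinear_lsub[OF bil[OF x(2)]] bilinear_rsub[OF bil[OF x(2)]]
          bilinear_lmul[OF bil[OF x(2)]] bilinear_rmul[OF bil[OF x(2)]] power2_eq_square algebra_simps)
    have e2: "G c (x - ?k) (w + \<beta> *\<^sub>R h) (w + \<beta> *\<^sub>R h)
        = G c (x - ?k) w w + 2 * \<beta> * G c (x - ?k) w h + \<beta>\<^sup>2 * G c (x - ?k) h h"
      using G_commute[OF D(1) rng[OF x(3)], of h w]
      by (simp add: bilinear_ladd[OF bil[OF x(3)]] bilinear_radd[OF bil[OF x(3)]]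
          bilinear_lmul[OF bil[OF x(3)]] bilinear_rmul[OF bil[OF x(3)]] power2_eq_square algebra_simps)
    have "G c (x + ?k) w w + G c (x - ?k) w w \<le> 2 * G c x w w + B * (norm ?k)\<^sup>2 * (norm w)\<^sup>2"
      using D(9)[OF x(2,3,1), of w] by linarith
    also have "B * (norm ?k)\<^sup>2 * (norm w)\<^sup>2 \<le> B * (norm h)\<^sup>2 * (1 / l)\<^sup>2"
      using nk nw D(5) by (intro mult_mono power_mono mult_left_mono) auto
    finally have i1: "G c (x + ?k) w w + G c (x - ?k) w w \<le> 2 + B / l\<^sup>2 * (norm h)\<^sup>2"
      using w F_power2[OF D(1) rng[OF x(1)], of w] by (simp add: power_divide mult_ac)
    have "G c (x - ?k) w h - G c (x + ?k) w h \<le> B * norm ((x - ?k) - (x + ?k)) * norm w * norm h"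
      using D(8)[OF x(3,2), of w h] by linarith
    also have "(x - ?k) - (x + ?k) = - (2 *\<^sub>R ?k)"
      by (rule euclidean_eqI) (simp add: inner_simps)
    also have "B * norm (- (2 *\<^sub>R ?k)) * norm w * norm h \<le> B * (2 * norm h) * (1 / l) * norm h"
      using nk nw D(3,5) by (intro mult_mono mult_left_mono mult_nonneg_nonneg) auto
    finally have "2 * \<beta> * (G c (x - ?k) w h - G c (x + ?k) w h)
        \<le> 2 * \<beta> * (B * (2 * norm h) * (1 / l) * norm h)"
      using \<beta> by (intro mult_left_mono) auto
    then have i2: "2 * \<beta> * (G c (x - ?k) w h - G c (x + ?k) w h) \<le> 4 * \<beta> * B / l * (norm h)\<^sup>2"
      by (simp add: power2_eq_square mult_ac)
    have hh: "G c y h h \<le> L\<^sup>2 * (norm h)\<^sup>2" if "y \<in> K" for y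
    proof -
      have "(F c y h)\<^sup>2 \<le> (L * norm h)\<^sup>2"
        using D(7)[OF that] F_nonneg[OF D(1) rng[OF that]] by (intro power_mono) auto
      then show ?thesis by (simp add: F_power2[OF D(1) rng[OF that]] power_mult_distrib)
    qed
    have "\<beta>\<^sup>2 * (G c (x + ?k) h h + G c (x - ?k) h h) \<le> \<beta>\<^sup>2 * (2 * (L\<^sup>2 * (norm h)\<^sup>2))"
      using hh[OF x(2)] hh[OF x(3)] by (intro mult_left_mono) auto
    then have i3: "\<beta>\<^sup>2 * (G c (x + ?k) h h + G c (x - ?k) h h) \<le> 2 * \<beta>\<^sup>2 * L\<^sup>2 * (norm h)\<^sup>2"
      by (simp add: mult_ac)
    let ?G1 = "G c (x + ?k) (w - \<beta> *\<^sub>R h) (w - \<beta> *\<^sub>R h)"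
    let ?G2 = "G c (x - ?k) (w + \<beta> *\<^sub>R h) (w + \<beta> *\<^sub>R h)"
    have "?G1 + ?G2 = G c (x + ?k) w w + G c (x - ?k) w w
        + 2 * \<beta> * (G c (x - ?k) w h - G c (x + ?k) w h)
        + \<beta>\<^sup>2 * (G c (x + ?k) h h + G c (x - ?k) h h)"
      unfolding e1 e2 by (simp add: algebra_simps)
    also have "\<dots> \<le> 2 + B / l\<^sup>2 * (norm h)\<^sup>2 + 4 * \<beta> * B / l * (norm h)\<^sup>2
        + 2 * \<beta>\<^sup>2 * L\<^sup>2 * (norm h)\<^sup>2"
      by (rule add_mono[OF add_mono[OF i1 i2] i3])
    also have "\<dots> = 2 + 2 * (C * (norm h)\<^sup>2)" unfolding C_def by (simp add: distrib_right)
    finally have "2 * (F c (x + ?k) (w - \<beta> *\<^sub>R h) + F c (x - ?k) (w + \<beta> *\<^sub>R h))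
        \<le> 2 * (2 + C * (norm h)\<^sup>2)"
      using add_mono[OF sqrt_le[OF x(2), of "w - \<beta> *\<^sub>R h"] sqrt_le[OF x(3), of "w + \<beta> *\<^sub>R h"]]
      by (simp only: distrib_left)
    then show ?thesis by simp
  qed
  show ?thesis
  proof (cases "F c x v = 0")
    case True
    then have "v = 0" using D(3) D(6)[OF x(1), of v] by (auto simp: mult_le_0_iff)
    then show ?thesis using True F_zero[OF D(1) rng] x by simp
  next
    case False
    let ?s = "F c x v"
    have s: "?s > 0" using False F_nonneg[OF D(1) rng[OF x(1)], of v] by simp
    define w where "w = (1 / ?s) *\<^sub>R v"
    have w: "F c x w = 1" using s by (simp add: w_def F_scaleR[OF D(1) rng[OF x(1)]])
    have v: "v - (?s * \<beta>) *\<^sub>R h = ?s *\<^sub>R (w - \<beta> *\<^sub>R h)" "v + (?s * \<beta>) *\<^sub>R h = ?s *\<^sub>R (w + \<beta> *\<^sub>R h)"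
      using s by (auto simp: w_def algebra_simps)
    show ?thesis
      unfolding v F_scaleR[OF D(1) rng[OF x(2)]] F_scaleR[OF D(1) rng[OF x(3)]]
      using mult_left_mono[OF unit[OF w], of ?s] s by (simp add: distrib_left)
  qed
qed

text \<open>The Riesz representation of a linear form: definiteness makes \<open>w \<mapsto> G c x w\<close> injective, hence
  surjective in finite dimension.\<close>

lemma metric_representation:
  assumes c: "c \<in> A" "x \<in> chart_range c" and \<xi>: "linear \<xi>"
  obtains w where "\<And>a. G c x w a = \<xi> a"
proof -
  note bil = bilinear_G[OF c]
  define T where "T a = (\<Sum>i\<in>Basis. G c x a i *\<^sub>R i)" for a
  have T: "T a \<bullet> i = G c x a i" if "i \<in> Basis" for a i
    using that by (simp add: T_def inner_sum_left inner_Basis if_distrib cong: if_cong)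
  have "linear T"
    by (rule linearI; rule euclidean_eqI)
      (auto simp: T inner_simps bilinear_ladd[OF bil] bilinear_lmul[OF bil])
  moreover have "a = 0" if "T a = 0" for a
  proof -
    have "G c x a i = 0" if "i \<in> Basis" for i using T[OF that, of a] \<open>T a = 0\<close> by simp
    then have "G c x a a = 0"
      using linear_expand[of "G c x a" a] bil unfolding bilinear_def by simp
    then show ?thesis using G_pos[OF c, of a] by force
  qed
  ultimately have "surj T"
    using linear_injective_imp_surjective linear_injective_0 by blast
  then obtain w where w: "T w = (\<Sum>i\<in>Basis. \<xi> i *\<^sub>R i)" by (metis surjD)
  have "G c x w i = \<xi> i" if "i \<in> Basis" for i
    using T[OF that, of w] that unfolding w
    by (simp add: inner_sum_left inner_Basis if_distrib cong: if_cong)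
  then have "G c x w a = \<xi> a" for a
    using linear_expand[OF \<xi>, of a] linear_expand[of "G c x w" a] bil unfolding bilinear_def by simp
  then show ?thesis by (rule that)
qed

text \<open>The chart is the one selected by \<^const>\<open>differential\<close>. The gradient \<open>w\<close> represents the differential, so the
  Cauchy-Schwarz inequality bounds the dual norm by the norm \<open>N\<close> of \<open>w\<close>, and the vector \<open>w / N\<close> attains
  it; for \<open>N = 0\<close> this vector is 0, which is still the correct maximizer. The last conclusion is the
  bound at \<open>w\<close> itself, where the differential takes the value \<open>N\<^sup>2\<close>.\<close>

lemma gradient_norm:
  fixes \<phi> :: "'m \<Rightarrow> real" and p :: 'm
  defines "c \<equiv> (SOME c. c \<in> charts_at A p)"
  defines "\<xi> \<equiv> frechet_derivative (\<phi> \<circ> chart_inv c) (at (chart_map c p))"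
  assumes \<xi>: "linear \<xi>"
  obtains N where "0 \<le> N" "tangent_norm g p (gradient A g \<phi> p) = N"
    "cotangent_norm A g p (differential A \<phi> p) = N"
    "\<And>a. \<bar>\<xi> a\<bar> \<le> N * F c (chart_map c p) a"
    "(\<And>a. \<bar>\<xi> a\<bar> \<le> F c (chart_map c p) a) \<Longrightarrow> N \<le> 1"
proof -
  have cp: "c \<in> charts_at A p" unfolding c_def using exists_chart someI_ex by metis
  then have c: "c \<in> A" "p \<in> chart_dom c" by (auto simp: charts_at_iff)
  let ?z = "chart_map c p"
  have z: "?z \<in> chart_range c" using c by blast
  note cz = c(1) z
  obtain w where w: "\<And>a. G c ?z w a = \<xi> a" using metric_representation[OF cz \<xi>] by blast
  have g: "g p (coord_vec A c p a) (coord_vec A c p b) = G c ?z a b" for a b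
    using c by (simp add: metric_coords_def)
  have diff: "differential A \<phi> p v = \<xi> (v c)" for v
    unfolding differential_def Let_def \<xi>_def c_def ..
  let ?W = "coord_vec A c p w"
  have "gradient A g \<phi> p = ?W" unfolding gradient_def
  proof (rule the_equality)
    show "?W \<in> tangent_space A p \<and> (\<forall>v\<in>tangent_space A p. g p ?W v = differential A \<phi> p v)"
      using coord_vec_in_tangent_space[OF cp] g w coord_vec_component[OF cp] diff by metis
  next
    fix W assume W: "W \<in> tangent_space A p \<and> (\<forall>v\<in>tangent_space A p. g p W v = differential A \<phi> p v)"
    have "G c ?z (W c) a = \<xi> a" for a
      using W coord_vec_in_tangent_space[OF cp] coord_vec_component[OF cp] coord_vec_self[OF cp] diff g
      by metis
    then have "G c ?z (W c - w) (W c - w) = 0"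
      using w by (simp add: bilinear_lsub[OF bilinear_G[OF cz]])
    then have "W c = w" using G_pos[OF cz, of "W c - w"] by force
    then show "W = ?W" using coord_vec_component[OF cp] W by metis
  qed
  then have n1: "tangent_norm g p (gradient A g \<phi> p) = F c ?z w"
    by (simp add: tangent_norm_def F_def g)
  have bound: "\<bar>\<xi> a\<bar> \<le> F c ?z w * F c ?z a" for a using G_Cauchy_Schwarz[OF cz, of w a] w by simp
  have tn: "tangent_norm g p v = F c ?z (v c)" if "v \<in> tangent_space A p" for v
    using coord_vec_component[OF cp that] g unfolding tangent_norm_def F_def by metis
  have ww: "\<xi> w = (F c ?z w)\<^sup>2" using w F_power2[OF cz] by simp
  have n2: "cotangent_norm A g p (differential A \<phi> p) = F c ?z w"
    unfolding cotangent_norm_def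
  proof (rule cSup_eq_maximum)
    let ?v = "coord_vec A c p ((1 / F c ?z w) *\<^sub>R w)"
    have "differential A \<phi> p ?v = F c ?z w"
      unfolding diff coord_vec_self[OF cp] linear_scale[OF \<xi>] by (simp add: ww power2_eq_square)
    moreover have "tangent_norm g p ?v \<le> 1"
      using F_nonneg[OF cz, of w]
      by (simp add: tn coord_vec_in_tangent_space[OF cp] coord_vec_self[OF cp] F_scaleR[OF cz])
    moreover have "F c ?z w = \<bar>F c ?z w\<bar>" using F_nonneg[OF cz, of w] by simp
    ultimately show "F c ?z w \<in> {\<bar>differential A \<phi> p v\<bar> |v. v \<in> tangent_space A p \<and> tangent_norm g p v \<le> 1}"
      using coord_vec_in_tangent_space[OF cp] by (metis (mono_tags, lifting) mem_Collect_eq)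
  next
    fix s assume "s \<in> {\<bar>differential A \<phi> p v\<bar> |v. v \<in> tangent_space A p \<and> tangent_norm g p v \<le> 1}"
    then obtain v where v: "s = \<bar>\<xi> (v c)\<bar>" "F c ?z (v c) \<le> 1" using diff tn by force
    have "F c ?z w * F c ?z (v c) \<le> F c ?z w * 1"
      by (rule mult_left_mono[OF v(2) F_nonneg[OF cz]])
    then show "s \<le> F c ?z w" using bound[of "v c"] v by simp
  qed
  have "F c ?z w \<le> 1" if "\<And>a. \<bar>\<xi> a\<bar> \<le> F c ?z a"
    using that[of w] ww F_nonneg[OF cz, of w]
    by (smt (verit) mult_le_cancel_right2 power2_eq_square)
  then show ?thesis using that[OF F_nonneg[OF cz] n1 n2 bound] by blast
qed

end

section \<open>Piecewise smooth curves and their lengths\<close>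

context smooth_manifold
begin

abbreviation chart_velocity :: "('m, 'e) chart \<Rightarrow> (real \<Rightarrow> 'm) \<Rightarrow> real \<Rightarrow> real \<Rightarrow> real \<Rightarrow> 'e" where
  "chart_velocity c \<gamma> a b t \<equiv> vector_derivative (chart_map c \<circ> \<gamma>) (at t within {a..b})"

lemma C1_curve_chart_derivative:
  assumes "C1_curve A \<gamma> a b" "c \<in> A" "t \<in> {a..b}" "\<gamma> t \<in> chart_dom c"
  shows "((chart_map c \<circ> \<gamma>) has_vector_derivative chart_velocity c \<gamma> a b t) (at t within {a..b})"
  using assms unfolding C1_curve_def vector_derivative_works[symmetric] by blast

lemma C1_curveI:
  assumes ab: "a < b" and cont: "continuous_on {a..b} \<gamma>"
    and D: "\<And>c t. c \<in> A \<Longrightarrow> t \<in> {a..b} \<Longrightarrow> \<gamma> t \<in> chart_dom c \<Longrightarrow>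
      ((chart_map c \<circ> \<gamma>) has_vector_derivative D c t) (at t within {a..b})"
    and contD: "\<And>c. c \<in> A \<Longrightarrow> continuous_on {t\<in>{a..b}. \<gamma> t \<in> chart_dom c} (D c)"
  shows "C1_curve A \<gamma> a b"
  unfolding C1_curve_def
proof (intro conjI ballI impI ab cont)
  fix c t assume "c \<in> A" "t \<in> {a..b}" "\<gamma> t \<in> chart_dom c"
  then show "(chart_map c \<circ> \<gamma>) differentiable at t within {a..b}"
    using D differentiableI_vector by blast
next
  fix c assume c: "c \<in> A"
  show "continuous_on {t\<in>{a..b}. \<gamma> t \<in> chart_dom c} (chart_velocity c \<gamma> a b)"
  proof (rule continuous_on_eq[OF contD[OF c]])
    fix t assume "t \<in> {t\<in>{a..b}. \<gamma> t \<in> chart_dom c}"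
    then show "D c t = chart_velocity c \<gamma> a b t"
      using vector_derivative_within_closed_interval[OF ab _ D[OF c, of t]] by simp
  qed
qed

lemma curve_stays_in_open:
  fixes \<gamma> :: "real \<Rightarrow> 'm"
  assumes "continuous_on {a..b} \<gamma>" "t \<in> {a..b}" "open W" "\<gamma> t \<in> W"
  obtains d where "d > 0" "\<And>s. s \<in> {a..b} \<Longrightarrow> dist s t < d \<Longrightarrow> \<gamma> s \<in> W"
proof -
  have "\<forall>\<^sub>F s in at t within {a..b}. \<gamma> s \<in> W"
    using assms topological_tendstoD unfolding continuous_on_def by blast
  then obtain d where "d > 0" "\<And>s. s \<in> {a..b} \<Longrightarrow> s \<noteq> t \<Longrightarrow> dist s t < d \<Longrightarrow> \<gamma> s \<in> W"
    unfolding eventually_at by blast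
  then show ?thesis using that assms(4) by metis
qed

lemma chart_velocity_change:
  assumes \<gamma>: "C1_curve A \<gamma> a b" and t: "t \<in> {a..b}"
    and c: "c \<in> charts_at A (\<gamma> t)" and c': "c' \<in> charts_at A (\<gamma> t)"
  shows "chart_velocity c' \<gamma> a b t = jacobian c c' (\<gamma> t) (chart_velocity c \<gamma> a b t)"
proof -
  have ab: "a < b" and cont: "continuous_on {a..b} \<gamma>" using \<gamma> by (auto simp: C1_curve_def)
  have cA: "c \<in> A" "\<gamma> t \<in> chart_dom c" using c by (auto simp: charts_at_iff)
  let ?J = "jacobian c c' (\<gamma> t)" and ?v = "chart_velocity c \<gamma> a b t"
  have "((transition c c' \<circ> (chart_map c \<circ> \<gamma>)) has_derivative ?J \<circ> (\<lambda>r. r *\<^sub>R ?v)) (at t within {a..b})"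
    using C1_curve_chart_derivative[OF \<gamma> cA(1) t cA(2)] transition_has_derivative[OF c c']
    by (intro diff_chain_within) (auto simp: has_vector_derivative_def intro: has_derivative_at_withinI)
  moreover have "?J \<circ> (\<lambda>r. r *\<^sub>R ?v) = (\<lambda>r. r *\<^sub>R ?J ?v)"
    by (rule ext) (simp only: o_apply linear_scale[OF linear_jacobian[OF c c']])
  ultimately have chain: "((transition c c' \<circ> (chart_map c \<circ> \<gamma>)) has_vector_derivative ?J ?v) (at t within {a..b})"
    by (simp only: has_vector_derivative_def)
  obtain d where d: "d > 0" "\<And>s. s \<in> {a..b} \<Longrightarrow> dist s t < d \<Longrightarrow> \<gamma> s \<in> chart_dom c"
    using curve_stays_in_open[OF cont t open_chart_dom[OF cA(1)] cA(2)] by blast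
  have "((chart_map c' \<circ> \<gamma>) has_vector_derivative ?J ?v) (at t within {a..b})"
    by (rule has_vector_derivative_transform_within[OF chain d(1) t]) (use d(2) cA(1) in auto)
  then show ?thesis using vector_derivative_within_closed_interval[OF ab t] by blast
qed

lemma velocity_eq_coord_vec:
  assumes "C1_curve A \<gamma> a b" "t \<in> {a..b}" "c \<in> A" "\<gamma> t \<in> chart_dom c"
  shows "velocity A \<gamma> {a..b} t = coord_vec A c (\<gamma> t) (chart_velocity c \<gamma> a b t)"
proof (rule ext)
  fix c'
  have c: "c \<in> charts_at A (\<gamma> t)" using assms by (simp add: charts_at_iff)
  show "velocity A \<gamma> {a..b} t c' = coord_vec A c (\<gamma> t) (chart_velocity c \<gamma> a b t) c'"
    using chart_velocity_change[OF assms(1,2) c, of c']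
    by (simp only: velocity_def coord_vec_def split: if_split) blast
qed

lemma velocity_eq:
  assumes ab: "a < b" "t \<in> {a..b}"
    and D: "\<And>c. c \<in> charts_at A (\<gamma> t) \<Longrightarrow>
      ((chart_map c \<circ> \<gamma>) has_vector_derivative D c) (at t within {a..b})"
  shows "velocity A \<gamma> {a..b} t = (\<lambda>c. if c \<in> charts_at A (\<gamma> t) then D c else 0)"
  unfolding velocity_def
  by (rule ext) (auto dest!: D vector_derivative_within_closed_interval[OF ab])

lemma C1_curve_subinterval:
  assumes \<gamma>: "C1_curve A \<gamma> a b" and sub: "a \<le> a'" "a' < b'" "b' \<le> b"
  shows "C1_curve A \<gamma> a' b'"
proof (rule C1_curveI[OF sub(2)])
  have ss: "{a'..b'} \<subseteq> {a..b}" using sub by auto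
  show "continuous_on {a'..b'} \<gamma>"
    using \<gamma> ss continuous_on_subset unfolding C1_curve_def by blast
  show "((chart_map c \<circ> \<gamma>) has_vector_derivative chart_velocity c \<gamma> a b t) (at t within {a'..b'})"
    if "c \<in> A" "t \<in> {a'..b'}" "\<gamma> t \<in> chart_dom c" for c t
    using has_vector_derivative_within_subset[OF C1_curve_chart_derivative[OF \<gamma>] ss] that ss by blast
  show "continuous_on {t \<in> {a'..b'}. \<gamma> t \<in> chart_dom c} (chart_velocity c \<gamma> a b)" if "c \<in> A" for c
    by (rule continuous_on_subset[of "{t \<in> {a..b}. \<gamma> t \<in> chart_dom c}"])
      (use \<gamma> that ss in \<open>auto simp: C1_curve_def\<close>)
qed

abbreviation pw :: "(real \<Rightarrow> 'm) \<Rightarrow> real \<Rightarrow> real \<Rightarrow> bool" where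
  "pw \<equiv> piecewise_C1_curve A"

lemma pw_refl: "pw \<gamma> a a"
  unfolding piecewise_C1_curve_def by (intro exI[of _ 0] exI[of _ "\<lambda>_. a"]) simp

lemma pw_snoc:
  assumes "pw \<gamma> a m" "C1_curve A \<gamma> m b" shows "pw \<gamma> a b"
proof -
  obtain n \<tau> where \<tau>: "\<tau> 0 = a" "\<tau> n = m" "\<And>i. i < n \<Longrightarrow> C1_curve A \<gamma> (\<tau> i) (\<tau> (Suc i))"
    using assms(1) unfolding piecewise_C1_curve_def by blast
  show ?thesis unfolding piecewise_C1_curve_def
    by (intro exI[of _ "Suc n"] exI[of _ "\<tau>(Suc n := b)"])
      (use \<tau> assms(2) in \<open>auto simp: less_Suc_eq\<close>)
qed

text \<open>Curves grow by appending smooth pieces at the end. Every estimate below is additive over pieces, so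
  this rule reduces it to a single smooth piece.\<close>

lemma pw_induct [consumes 1, case_names refl snoc]:
  assumes "pw \<gamma> a b" and "P a"
    and snoc: "\<And>m b. pw \<gamma> a m \<Longrightarrow> P m \<Longrightarrow> C1_curve A \<gamma> m b \<Longrightarrow> P b"
  shows "P b"
proof -
  obtain n \<tau> where \<tau>: "\<tau> 0 = a" "\<tau> n = b" "\<And>i. i < n \<Longrightarrow> C1_curve A \<gamma> (\<tau> i) (\<tau> (Suc i))"
    using assms(1) unfolding piecewise_C1_curve_def by blast
  have "k \<le> n \<Longrightarrow> pw \<gamma> a (\<tau> k) \<and> P (\<tau> k)" for k
  proof (induction k)
    case 0
    then show ?case using \<tau>(1) assms(2) pw_refl by simp
  next
    case (Suc k)
    then show ?case using \<tau>(3)[of k] pw_snoc[of \<gamma> a "\<tau> k"] snoc[of "\<tau> k"] by simp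
  qed
  then show ?thesis using \<tau>(2) by blast
qed

lemma pw_C1: "C1_curve A \<gamma> a b \<Longrightarrow> pw \<gamma> a b"
  using pw_snoc pw_refl by blast

lemma pw_le: "pw \<gamma> a b \<Longrightarrow> a \<le> b"
  by (induction rule: pw_induct) (auto simp: C1_curve_def)

lemma pw_continuous: "pw \<gamma> a b \<Longrightarrow> continuous_on {a..b} \<gamma>"
proof (induction rule: pw_induct)
  case (snoc m b)
  then have "continuous_on ({a..m} \<union> {m..b}) \<gamma>"
    by (intro continuous_on_closed_Un) (auto simp: C1_curve_def)
  moreover have "{a..m} \<union> {m..b} = {a..b}" using snoc pw_le by (force simp: C1_curve_def)
  ultimately show ?case by simp
qed simp

lemma pw_trans: "pw \<gamma> m b \<Longrightarrow> pw \<gamma> a m \<Longrightarrow> pw \<gamma> a b"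
  by (induction rule: pw_induct) (auto intro: pw_snoc)

lemma pw_split:
  assumes "pw \<gamma> a b" "t \<in> {a..b}" shows "pw \<gamma> a t \<and> pw \<gamma> t b"
  using assms
proof (induction arbitrary: t rule: pw_induct)
  case refl
  then show ?case using pw_refl by simp
next
  case (snoc m b)
  show ?case
  proof (cases "t \<le> m")
    case True
    then show ?thesis using snoc.IH[of t] snoc.hyps(2) snoc.prems pw_snoc[of \<gamma> t m b] by simp
  next
    case False
    then have "C1_curve A \<gamma> m t"
      using C1_curve_subinterval[OF snoc.hyps(2), of m t] snoc.prems by simp
    moreover have "pw \<gamma> t b"
      using C1_curve_subinterval[OF snoc.hyps(2), of t b] False snoc.prems pw_C1 pw_refl
      by (cases "t = b") auto
    ultimately show ?thesis using snoc.hyps(1) pw_snoc by blast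
  qed
qed

end

context riemannian
begin

definition speed :: "(real \<Rightarrow> 'm) \<Rightarrow> real \<Rightarrow> real \<Rightarrow> real \<Rightarrow> real" where
  "speed \<gamma> a b t = tangent_norm g (\<gamma> t) (velocity A \<gamma> {a..b} t)"

abbreviation len :: "(real \<Rightarrow> 'm) \<Rightarrow> real \<Rightarrow> real \<Rightarrow> real" where
  "len \<equiv> curve_length A g"

lemma len_eq: "len \<gamma> a b = integral {a..b} (speed \<gamma> a b)"
  unfolding curve_length_def speed_def ..

lemma speed_eq_F:
  assumes "C1_curve A \<gamma> a b" "t \<in> {a..b}" "c \<in> A" "\<gamma> t \<in> chart_dom c"
  shows "speed \<gamma> a b t = F c (chart_map c (\<gamma> t)) (chart_velocity c \<gamma> a b t)"
  unfolding speed_def velocity_eq_coord_vec[OF assms] tangent_norm_def F_def metric_coords_def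
  using assms by simp

lemma speed_nonneg:
  assumes "C1_curve A \<gamma> a b" "t \<in> {a..b}" shows "0 \<le> speed \<gamma> a b t"
proof -
  obtain c where "c \<in> A" "\<gamma> t \<in> chart_dom c" using exists_chart charts_at_iff by blast
  then show ?thesis using speed_eq_F[OF assms] F_nonneg by simp
qed

lemma continuous_on_speed:
  assumes \<gamma>: "C1_curve A \<gamma> a b" shows "continuous_on {a..b} (speed \<gamma> a b)"
  unfolding continuous_on_eq_continuous_within
proof
  fix t assume t: "t \<in> {a..b}"
  have cont: "continuous_on {a..b} \<gamma>" using \<gamma> by (auto simp: C1_curve_def)
  obtain c where c: "c \<in> A" "\<gamma> t \<in> chart_dom c" using exists_chart charts_at_iff by blast
  let ?S = "{s\<in>{a..b}. \<gamma> s \<in> chart_dom c}"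
  obtain d where d: "d > 0" "\<And>s. s \<in> {a..b} \<Longrightarrow> dist s t < d \<Longrightarrow> \<gamma> s \<in> chart_dom c"
    using curve_stays_in_open[OF cont t open_chart_dom[OF c(1)] c(2)] by blast
  have "continuous_on ?S (\<lambda>s. F c (chart_map c (\<gamma> s)) (chart_velocity c \<gamma> a b s))"
  proof (rule continuous_on_F[OF c(1)])
    show "continuous_on ?S (\<lambda>s. chart_map c (\<gamma> s))"
      by (rule continuous_on_compose2[OF continuous_on_chart_map[OF c(1)]
            continuous_on_subset[OF cont]]) auto
    show "continuous_on ?S (chart_velocity c \<gamma> a b)" using \<gamma> c(1) unfolding C1_curve_def by blast
  qed auto
  then have "continuous_on ?S (speed \<gamma> a b)"
    by (rule continuous_on_eq) (simp add: speed_eq_F[OF \<gamma> _ c(1)])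
  then have "continuous (at t within ?S) (speed \<gamma> a b)"
    using t c(2) by (simp add: continuous_on_eq_continuous_within)
  moreover have "at t within ?S = at t within {a..b}"
    by (rule at_within_nhd[of _ "ball t d"]) (use d in \<open>auto simp: dist_commute\<close>)
  ultimately show "continuous (at t within {a..b}) (speed \<gamma> a b)" by simp
qed

lemma C1_integrable: "C1_curve A \<gamma> a b \<Longrightarrow> speed \<gamma> a b integrable_on {a..b}"
  by (intro integrable_continuous_real continuous_on_speed)

text \<open>Away from the end points the one-sided derivatives are ordinary derivatives, so the speed does not
  depend on the parameter interval. Finitely many exceptional points do not affect lengths.\<close>

lemma speed_interior:
  assumes "t \<in> {a'<..<b'}" "a \<le> a'" "b' \<le> b" shows "speed \<gamma> a b t = speed \<gamma> a' b' t"
proof -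
  have "at t within {a..b} = at t" "at t within {a'..b'} = at t"
    using assms by (auto intro!: at_within_Icc_at)
  note eqs = this
  show ?thesis unfolding speed_def velocity_def eqs ..
qed

lemma len_combine:
  assumes m: "a \<le> m" "m \<le> b"
    and int: "speed \<gamma> a m integrable_on {a..m}" "speed \<gamma> m b integrable_on {m..b}"
  shows "speed \<gamma> a b integrable_on {a..b}" "len \<gamma> a b = len \<gamma> a m + len \<gamma> m b"
proof -
  have "(speed \<gamma> a b has_integral len \<gamma> a m) {a..m}"
    by (rule has_integral_spike_finite[of "{a, m}" _ _ "speed \<gamma> a m"])
      (use m speed_interior[of _ a m a b] integrable_integral[OF int(1)] in \<open>auto simp: len_eq\<close>)
  moreover have "(speed \<gamma> a b has_integral len \<gamma> m b) {m..b}"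
    by (rule has_integral_spike_finite[of "{m, b}" _ _ "speed \<gamma> m b"])
      (use m speed_interior[of _ m b a b] integrable_integral[OF int(2)] in \<open>auto simp: len_eq\<close>)
  ultimately have "(speed \<gamma> a b has_integral len \<gamma> a m + len \<gamma> m b) {a..b}"
    by (rule has_integral_combine[OF m])
  then show "speed \<gamma> a b integrable_on {a..b}" "len \<gamma> a b = len \<gamma> a m + len \<gamma> m b"
    by (auto simp: len_eq[of \<gamma> a b])
qed

lemma len_refl: "len \<gamma> a a = 0"
  by (simp add: len_eq)

lemma pw_integrable: "pw \<gamma> a b \<Longrightarrow> speed \<gamma> a b integrable_on {a..b}"
proof (induction rule: pw_induct)
  case (snoc m b)
  then show ?case
    by (intro len_combine(1)[of a m b]) (auto simp: C1_curve_def C1_integrable pw_le)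
qed (use integrable_on_refl[of "speed \<gamma> a a" a] in simp)

lemma len_add: "pw \<gamma> a m \<Longrightarrow> pw \<gamma> m b \<Longrightarrow> len \<gamma> a b = len \<gamma> a m + len \<gamma> m b"
  by (intro len_combine(2) pw_le pw_integrable)

lemma len_snoc: "pw \<gamma> a m \<Longrightarrow> C1_curve A \<gamma> m b \<Longrightarrow> len \<gamma> a b = len \<gamma> a m + len \<gamma> m b"
  using len_add pw_C1 by blast

lemma len_C1_nonneg: "C1_curve A \<gamma> a b \<Longrightarrow> 0 \<le> len \<gamma> a b"
  unfolding len_eq by (intro integral_nonneg C1_integrable speed_nonneg)

lemma len_nonneg: "pw \<gamma> a b \<Longrightarrow> 0 \<le> len \<gamma> a b"
  by (induction rule: pw_induct) (auto simp: len_refl len_snoc len_C1_nonneg)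

lemma len_mono: "pw \<gamma> a b \<Longrightarrow> t \<in> {a..b} \<Longrightarrow> len \<gamma> a t \<le> len \<gamma> a b"
  using len_add[of \<gamma> a t b] len_nonneg[of \<gamma> t b] pw_split[of \<gamma> a b t] by simp

lemma continuous_on_len:
  assumes "pw \<gamma> a b" shows "continuous_on {a..b} (\<lambda>t. len \<gamma> a t)"
proof (rule continuous_on_eq[OF indefinite_integral_continuous_1[OF pw_integrable[OF assms]]])
  fix t assume t: "t \<in> {a..b}"
  show "integral {a..t} (speed \<gamma> a b) = len \<gamma> a t"
    unfolding len_eq
    by (rule integral_spike[of "{a, t}"]) (use t speed_interior[of _ a t a b] in auto)
qed

text \<open>Besides translating the parameter, the case \<open>d = 0\<close> says that only the values on the interval
  matter. Both are needed to join two curves with unrelated parameter intervals.\<close>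

lemma C1_curve_translate:
  assumes \<gamma>: "C1_curve A \<gamma> (a + d) (b + d)" and eq: "\<And>t. t \<in> {a..b} \<Longrightarrow> \<gamma>' t = \<gamma> (t + d)"
  shows "C1_curve A \<gamma>' a b" "len \<gamma>' a b = len \<gamma> (a + d) (b + d)"
proof -
  let ?I = "{a + d..b + d}"
  have ab: "a < b" and cont: "continuous_on ?I \<gamma>" using \<gamma> by (auto simp: C1_curve_def)
  have img: "(\<lambda>t. t + d) ` {a..b} = ?I" by simp
  have der: "((chart_map c \<circ> \<gamma>') has_vector_derivative chart_velocity c \<gamma> (a + d) (b + d) (t + d))
      (at t within {a..b})" if "c \<in> A" "t \<in> {a..b}" "\<gamma>' t \<in> chart_dom c" for c t
  proof -
    have "((chart_map c \<circ> \<gamma>) has_vector_derivative chart_velocity c \<gamma> (a + d) (b + d) (t + d))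
        (at (t + d) within ?I)"
      using C1_curve_chart_derivative[OF \<gamma> that(1), of "t + d"] that eq by simp
    then have "(((chart_map c \<circ> \<gamma>) \<circ> (\<lambda>t. t + d)) has_vector_derivative
        1 *\<^sub>R chart_velocity c \<gamma> (a + d) (b + d) (t + d)) (at t within {a..b})"
      by (intro vector_diff_chain_within) (auto simp: img intro!: derivative_eq_intros)
    then have "(((chart_map c \<circ> \<gamma>) \<circ> (\<lambda>t. t + d)) has_vector_derivative
        chart_velocity c \<gamma> (a + d) (b + d) (t + d)) (at t within {a..b})"
      by (simp only: scaleR_one)
    then show ?thesis by (rule has_vector_derivative_transform[OF that(2), rotated]) (simp add: eq)
  qed
  show "C1_curve A \<gamma>' a b"
  proof (rule C1_curveI[OF ab _ der])
    show "continuous_on {a..b} \<gamma>'"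
      by (rule continuous_on_eq[of _ "\<lambda>t. \<gamma> (t + d)"])
        (auto simp: eq intro!: continuous_on_compose2[OF cont] continuous_intros)
    fix c assume "c \<in> A"
    then have "continuous_on {t \<in> ?I. \<gamma> t \<in> chart_dom c} (chart_velocity c \<gamma> (a + d) (b + d))"
      using \<gamma> unfolding C1_curve_def by blast
    then show "continuous_on {t \<in> {a..b}. \<gamma>' t \<in> chart_dom c}
        (\<lambda>t. chart_velocity c \<gamma> (a + d) (b + d) (t + d))"
      by (rule continuous_on_compose2) (auto simp: eq intro!: continuous_intros)
  qed
  have "speed \<gamma>' a b t = speed \<gamma> (a + d) (b + d) (t + d)" if t: "t \<in> {a..b}" for t
  proof -
    have "velocity A \<gamma>' {a..b} t
        = (\<lambda>c. if c \<in> charts_at A (\<gamma>' t) then chart_velocity c \<gamma> (a + d) (b + d) (t + d) else 0)"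
      by (rule velocity_eq[OF ab t]) (use der t in \<open>auto simp: charts_at_iff\<close>)
    then show ?thesis using eq[OF t] by (simp only: speed_def velocity_def)
  qed
  then have "len \<gamma>' a b = integral {a..b} (speed \<gamma> (a + d) (b + d) \<circ> (\<lambda>t. t + d))"
    unfolding len_eq by (intro integral_cong) simp
  also have "\<dots> = len \<gamma> (a + d) (b + d)"
    unfolding len_eq by (rule integral_shift[OF continuous_on_speed[OF \<gamma>]])
  finally show "len \<gamma>' a b = len \<gamma> (a + d) (b + d)" .
qed

lemma pw_translate:
  assumes "pw \<gamma> a b" "\<And>t. t \<in> {a - d..b - d} \<Longrightarrow> \<gamma>' t = \<gamma> (t + d)"
  shows "pw \<gamma>' (a - d) (b - d) \<and> len \<gamma>' (a - d) (b - d) = len \<gamma> a b"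
  using assms
proof (induction rule: pw_induct)
  case refl
  then show ?case using pw_refl len_refl by simp
next
  case (snoc m b)
  have "C1_curve A \<gamma>' (m - d) (b - d)" "len \<gamma>' (m - d) (b - d) = len \<gamma> m b"
    using C1_curve_translate[of \<gamma> "m - d" d "b - d" \<gamma>'] snoc.hyps(2) snoc.prems
      pw_le[OF snoc.hyps(1)] by auto
  moreover have "pw \<gamma>' (a - d) (m - d) \<and> len \<gamma>' (a - d) (m - d) = len \<gamma> a m"
    by (rule snoc.IH) (use snoc.hyps(2) snoc.prems in \<open>auto simp: C1_curve_def\<close>)
  ultimately show ?case using snoc.hyps pw_snoc len_snoc by metis
qed

lemma pw_concat:
  assumes \<gamma>1: "pw \<gamma>1 a b" and \<gamma>2: "pw \<gamma>2 a' b'" and join: "\<gamma>1 b = \<gamma>2 a'"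
  obtains \<gamma> e where "pw \<gamma> a e" "\<gamma> a = \<gamma>1 a" "\<gamma> e = \<gamma>2 b'" "len \<gamma> a e = len \<gamma>1 a b + len \<gamma>2 a' b'"
proof -
  define d where "d = a' - b"
  define \<gamma> where "\<gamma> t = (if t \<le> b then \<gamma>1 t else \<gamma>2 (t + d))" for t
  have 1: "pw \<gamma> a b \<and> len \<gamma> a b = len \<gamma>1 a b"
    using pw_translate[OF \<gamma>1, of 0 \<gamma>] by (simp add: \<gamma>_def)
  have eq: "\<gamma> t = \<gamma>2 (t + d)" if "t \<ge> b" for t using that join by (auto simp: \<gamma>_def d_def)
  have 2: "pw \<gamma> b (b' - d) \<and> len \<gamma> b (b' - d) = len \<gamma>2 a' b'"
    using pw_translate[OF \<gamma>2, of d \<gamma>] eq by (simp add: d_def)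
  show ?thesis
  proof (rule that[of \<gamma> "b' - d"])
    show "pw \<gamma> a (b' - d)" using 1 2 pw_trans by blast
    show "\<gamma> a = \<gamma>1 a" using pw_le[OF \<gamma>1] by (simp add: \<gamma>_def)
    show "\<gamma> (b' - d) = \<gamma>2 b'" using eq pw_le[OF \<gamma>2] by (simp add: d_def)
    show "len \<gamma> a (b' - d) = len \<gamma>1 a b + len \<gamma>2 a' b'" using 1 2 len_add by metis
  qed
qed

text \<open>In any other chart the curve is the image of \<open>\<kappa>\<close> under a smooth transition map, so the chain rule
  gives its velocity there.\<close>

lemma C1_curve_from_chart:
  assumes c: "c \<in> A" and ab: "a < b" and rng: "\<And>t. t \<in> {a..b} \<Longrightarrow> \<kappa> t \<in> chart_range c"
    and \<kappa>: "\<And>t. t \<in> {a..b} \<Longrightarrow> (\<kappa> has_vector_derivative D t) (at t within {a..b})"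
    and D: "continuous_on {a..b} D"
  shows "C1_curve A (chart_inv c \<circ> \<kappa>) a b"
    "len (chart_inv c \<circ> \<kappa>) a b = integral {a..b} (\<lambda>t. F c (\<kappa> t) (D t))"
proof -
  let ?\<gamma> = "chart_inv c \<circ> \<kappa>"
  have cont: "continuous_on {a..b} \<kappa>"
    using \<kappa> has_vector_derivative_continuous continuous_on_eq_continuous_within by blast
  have der: "((chart_map c' \<circ> ?\<gamma>) has_vector_derivative
      frechet_derivative (transition c c') (at (\<kappa> t)) (D t)) (at t within {a..b})"
    if "c' \<in> A" "t \<in> {a..b}" "?\<gamma> t \<in> chart_dom c'" for c' t
  proof -
    have ch: "c \<in> charts_at A (?\<gamma> t)" "c' \<in> charts_at A (?\<gamma> t)"
      using c that rng chart_inv_in_dom by (auto simp: charts_at_iff)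
    have eq: "chart_map c (?\<gamma> t) = \<kappa> t" using c rng that by simp
    note T = transition_has_derivative[OF ch, unfolded eq]
    have "((transition c c' \<circ> \<kappa>) has_derivative
        frechet_derivative (transition c c') (at (\<kappa> t)) \<circ> (\<lambda>r. r *\<^sub>R D t)) (at t within {a..b})"
      using \<kappa>[OF that(2)] T
      by (intro diff_chain_within) (auto simp: has_vector_derivative_def intro: has_derivative_at_withinI)
    moreover have "frechet_derivative (transition c c') (at (\<kappa> t)) \<circ> (\<lambda>r. r *\<^sub>R D t)
        = (\<lambda>r. r *\<^sub>R frechet_derivative (transition c c') (at (\<kappa> t)) (D t))"
      by (rule ext) (simp only: o_apply linear_scale[OF has_derivative_linear[OF T]])
    ultimately show ?thesis by (simp only: has_vector_derivative_def o_assoc)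
  qed
  show C1: "C1_curve A ?\<gamma> a b"
  proof (rule C1_curveI[OF ab _ der])
    show "continuous_on {a..b} ?\<gamma>"
      using rng by (intro continuous_on_compose cont continuous_on_subset[OF continuous_on_chart_inv[OF c]]) auto
    fix c' assume c': "c' \<in> A"
    let ?S = "{t \<in> {a..b}. ?\<gamma> t \<in> chart_dom c'}"
    note sm = smooth_transition[OF c c']
    have ov: "\<kappa> t \<in> overlap c (chart_dom c')" if "t \<in> ?S" for t
      using that rng by (simp add: overlap_eq[OF c])
    show "continuous_on ?S (\<lambda>t. frechet_derivative (transition c c') (at (\<kappa> t)) (D t))"
    proof (rule continuous_on_eq)
      show "continuous_on ?S (\<lambda>t. \<Sum>i\<in>Basis. (D t \<bullet> i) *\<^sub>R frechet_derivative (transition c c') (at (\<kappa> t)) i)"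
      proof (intro continuous_intros)
        show "continuous_on ?S D" by (rule continuous_on_subset[OF D]) auto
        show "continuous_on ?S (\<lambda>t. frechet_derivative (transition c c') (at (\<kappa> t)) i)" for i
          by (rule continuous_on_compose2[OF smooth_on_continuous[OF smooth_on_derivative[OF sm]]
                continuous_on_subset[OF cont]]) (use ov in auto)
      qed
      fix t assume "t \<in> ?S"
      then have "linear (frechet_derivative (transition c c') (at (\<kappa> t)))"
        using smooth_on_differentiable[OF sm ov] linear_frechet_derivative by blast
      then show "(\<Sum>i\<in>Basis. (D t \<bullet> i) *\<^sub>R frechet_derivative (transition c c') (at (\<kappa> t)) i)
          = frechet_derivative (transition c c') (at (\<kappa> t)) (D t)"
        using linear_expand by metis
    qed
  qed
  show "len ?\<gamma> a b = integral {a..b} (\<lambda>t. F c (\<kappa> t) (D t))"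
    unfolding len_eq
  proof (rule integral_cong)
    fix t assume t: "t \<in> {a..b}"
    have dom: "?\<gamma> t \<in> chart_dom c" using c rng[OF t] chart_inv_in_dom by simp
    have "((chart_map c \<circ> ?\<gamma>) has_vector_derivative D t) (at t within {a..b})"
      by (rule has_vector_derivative_transform[OF t _ \<kappa>[OF t]]) (use c rng in simp)
    then have vel: "chart_velocity c ?\<gamma> a b t = D t"
      using vector_derivative_within_closed_interval[OF ab t] by blast
    have eq: "chart_map c (?\<gamma> t) = \<kappa> t" using c rng[OF t] by simp
    show "speed ?\<gamma> a b t = F c (\<kappa> t) (D t)"
      by (simp only: speed_eq_F[OF C1 t c dom] eq vel)
  qed
qed

lemma segment_curve:
  assumes c: "c \<in> A" and W: "convex W" "W \<subseteq> chart_range c" and xy: "x \<in> W" "y \<in> W"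
    and bound: "\<And>z. z \<in> W \<Longrightarrow> F c z (y - x) \<le> r"
  obtains \<gamma> where "pw \<gamma> 0 1" "\<gamma> 0 = chart_inv c x" "\<gamma> 1 = chart_inv c y" "len \<gamma> 0 1 \<le> r"
proof -
  define \<kappa> where "\<kappa> t = x + t *\<^sub>R (y - x)" for t :: real
  have in_W: "\<kappa> t \<in> W" if "t \<in> {0..1}" for t
    using convexD_alt[OF W(1) xy, of t] that by (simp add: \<kappa>_def algebra_simps)
  have der: "(\<kappa> has_vector_derivative y - x) (at t within {0..1})" for t
    unfolding \<kappa>_def by (auto intro!: derivative_eq_intros)
  have cont: "continuous_on {0..1} (\<lambda>t. F c (\<kappa> t) (y - x))"
    using in_W W(2) by (intro continuous_on_F c) (auto simp: \<kappa>_def intro!: continuous_intros)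
  have \<gamma>: "C1_curve A (chart_inv c \<circ> \<kappa>) 0 1"
    "len (chart_inv c \<circ> \<kappa>) 0 1 = integral {0..1} (\<lambda>t. F c (\<kappa> t) (y - x))"
    using C1_curve_from_chart[OF c _ _ der] in_W W(2) by auto
  have "integral {0..1} (\<lambda>t. F c (\<kappa> t) (y - x)) \<le> integral {0..1} (\<lambda>t::real. r)"
    using in_W bound by (intro integral_le integrable_continuous_real cont) auto
  then show ?thesis
    by (intro that[of "chart_inv c \<circ> \<kappa>"]) (use \<gamma> pw_C1 in \<open>auto simp: \<kappa>_def\<close>)
qed

end

section \<open>Curves in a chart\<close>

context riemannian
begin

lemma exists_controlled_ball:
  assumes c: "c \<in> A" "z \<in> chart_range c"
  obtains R l L B where "R > 0" "controlled c (cball z R) l L B"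
proof -
  obtain R where R: "R > 0" "cball z R \<subseteq> chart_range c"
    using open_contains_cball open_chart_range[OF c(1)] c(2) by blast
  then obtain l L B where "controlled c (cball z R) l L B"
    using exists_controlled[OF c(1) compact_cball convex_cball R(2)] by blast
  then show ?thesis using that R(1) by blast
qed

lemma eventually_in_chart:
  assumes c: "c \<in> A" "x \<in> chart_dom c" and P: "\<forall>\<^sub>F y in nhds x. P y"
  obtains d where "d > 0" "ball (chart_map c x) d \<subseteq> chart_range c"
    "\<And>y. y \<in> ball (chart_map c x) d \<Longrightarrow> P (chart_inv c y)"
proof -
  obtain S where S: "open S" "x \<in> S" "\<And>y. y \<in> S \<Longrightarrow> P y" using P unfolding eventually_nhds by blast
  have "open (overlap c S)" "chart_map c x \<in> overlap c S" using open_overlap[OF c(1) S(1)] S(2) c(2) by auto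
  then obtain d where d: "d > 0" "ball (chart_map c x) d \<subseteq> overlap c S" using openE by blast
  then show ?thesis using that[of d] S(3) unfolding overlap_eq[OF c(1)] by blast
qed

text \<open>Integrating a linear form instead of a norm along the curve gives the sharp constant for the metric
  frozen at one point as well as for the Euclidean norm.\<close>

lemma linear_along_C1_curve:
  assumes c: "c \<in> A" and \<gamma>: "C1_curve A \<gamma> a b" and \<xi>: "linear \<xi>"
    and dom: "\<And>t. t \<in> {a..b} \<Longrightarrow> \<gamma> t \<in> chart_dom c"
    and bound: "\<And>t v. t \<in> {a..b} \<Longrightarrow> \<xi> v \<le> M * F c (chart_map c (\<gamma> t)) v"
  shows "\<xi> (chart_map c (\<gamma> b) - chart_map c (\<gamma> a)) \<le> M * len \<gamma> a b"
proof -
  have ab: "a \<le> b" using \<gamma> by (auto simp: C1_curve_def)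
  have "(chart_velocity c \<gamma> a b has_integral chart_map c (\<gamma> b) - chart_map c (\<gamma> a)) {a..b}"
    using fundamental_theorem_of_calculus[OF ab, of "chart_map c \<circ> \<gamma>"]
      C1_curve_chart_derivative[OF \<gamma> c] dom by simp
  then have 1: "((\<xi> \<circ> chart_velocity c \<gamma> a b) has_integral
      \<xi> (chart_map c (\<gamma> b) - chart_map c (\<gamma> a))) {a..b}"
    by (rule has_integral_linear) (use \<xi> linear_conv_bounded_linear in blast)
  have 2: "((\<lambda>t. M * speed \<gamma> a b t) has_integral M * len \<gamma> a b) {a..b}"
    unfolding len_eq by (intro has_integral_mult_right integrable_integral C1_integrable \<gamma>)
  show ?thesis
    by (rule has_integral_le[OF 1 2]) (use bound speed_eq_F[OF \<gamma> _ c] dom in simp)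
qed

lemma linear_along_curve:
  assumes "pw \<gamma> a b" and c: "c \<in> A" and \<xi>: "linear \<xi>"
    and "\<And>t. t \<in> {a..b} \<Longrightarrow> \<gamma> t \<in> chart_dom c"
    and "\<And>t v. t \<in> {a..b} \<Longrightarrow> \<xi> v \<le> M * F c (chart_map c (\<gamma> t)) v"
  shows "\<xi> (chart_map c (\<gamma> b) - chart_map c (\<gamma> a)) \<le> M * len \<gamma> a b"
  using assms(1,4,5)
proof (induction rule: pw_induct)
  case refl
  then show ?case using linear_0[OF \<xi>] len_refl by simp
next
  case (snoc m b)
  have mb: "a \<le> m" "m < b" using snoc.hyps pw_le by (auto simp: C1_curve_def)
  have "\<xi> (chart_map c (\<gamma> m) - chart_map c (\<gamma> a)) \<le> M * len \<gamma> a m"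
    using mb snoc.prems by (intro snoc.IH) auto
  moreover have "\<xi> (chart_map c (\<gamma> b) - chart_map c (\<gamma> m)) \<le> M * len \<gamma> m b"
    using mb snoc.prems by (intro linear_along_C1_curve[OF c snoc.hyps(2) \<xi>]) auto
  ultimately show ?case
    using len_snoc[OF snoc.hyps] by (simp add: linear_diff[OF \<xi>] distrib_left)
qed

lemma chart_displacement:
  assumes K: "controlled c K l L B" and \<gamma>: "pw \<gamma> a b"
    and dom: "\<And>t. t \<in> {a..b} \<Longrightarrow> \<gamma> t \<in> chart_dom c \<and> chart_map c (\<gamma> t) \<in> K"
  shows "norm (chart_map c (\<gamma> b) - chart_map c (\<gamma> a)) \<le> len \<gamma> a b / l"
proof -
  note D = controlledD[OF K]
  let ?z = "chart_map c (\<gamma> b) - chart_map c (\<gamma> a)"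
  \<comment> \<open>the component in the direction of the displacement\<close>
  let ?\<xi> = "\<lambda>v. v \<bullet> sgn ?z"
  have "?\<xi> ?z \<le> 1 / l * len \<gamma> a b"
  proof (rule linear_along_curve[OF \<gamma> D(1), where \<xi> = ?\<xi>])
    show "linear ?\<xi>" by (simp add: bounded_linear.linear bounded_linear_inner_left)
    fix t v assume t: "t \<in> {a..b}"
    have "v \<bullet> sgn ?z \<le> norm v * norm (sgn ?z)" by (rule norm_cauchy_schwarz)
    also have "\<dots> \<le> norm v" by (simp add: norm_sgn)
    also have "\<dots> \<le> 1 / l * F c (chart_map c (\<gamma> t)) v"
      using D(3) D(6)[of "chart_map c (\<gamma> t)" v] dom[OF t] by (simp add: field_simps)
    finally show "v \<bullet> sgn ?z \<le> 1 / l * F c (chart_map c (\<gamma> t)) v" .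
  qed (use dom in auto)
  moreover have "z \<bullet> sgn z = norm z" for z :: 'e
    by (cases "z = 0") (simp_all add: sgn_div_norm power2_norm_eq_inner[symmetric] power2_eq_square)
  ultimately show ?thesis by simp
qed

text \<open>A curve cannot leave the ball: up to a first exit time it would stay in the smaller closed ball of
  radius \<open>len \<gamma> a b / l\<close>, whose image in the manifold is compact and hence closed, so the exit point
  would still lie in the ball. Compactness in the Hausdorff manifold is what prevents the curve from
  leaving the chart domain without reaching the boundary of the coordinate ball.\<close>

lemma short_curve_stays_in_chart:
  assumes K: "controlled c K l L B" and \<gamma>: "pw \<gamma> a b"
    and start: "\<gamma> a \<in> chart_dom c" "chart_map c (\<gamma> a) = x"
    and \<rho>: "cball x \<rho> \<subseteq> K" "len \<gamma> a b < l * \<rho>" and t: "t \<in> {a..b}"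
  shows "\<gamma> t \<in> chart_dom c" "norm (chart_map c (\<gamma> t) - x) \<le> len \<gamma> a t / l"
proof -
  note D = controlledD[OF K]
  note cont = pw_continuous[OF \<gamma>]
  have ab: "a \<le> b" by (rule pw_le[OF \<gamma>])
  define r where "r = len \<gamma> a b / l"
  have r: "0 \<le> r" "r < \<rho>" using len_nonneg[OF \<gamma>] D(3) \<rho>(2) by (auto simp: r_def field_simps)
  have ball_rng: "cball x \<rho> \<subseteq> chart_range c" using \<rho>(1) D(2) by blast
  define W where "W = chart_inv c ` ball x \<rho>"
  define Q where "Q = chart_inv c ` cball x r"
  have "open W" unfolding W_def
    using ball_rng by (intro open_chart_inv_image D(1)) auto
  have "Q \<subseteq> W" unfolding W_def Q_def using r(2) by (intro image_mono) auto
  have "compact Q" unfolding Q_def using ball_rng r(2)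
    by (intro compact_continuous_image continuous_on_subset[OF continuous_on_chart_inv[OF D(1)]]) auto
  then have "closed Q" by (rule compact_imp_closed)
  have W: "p \<in> chart_dom c \<and> chart_map c p \<in> ball x \<rho>" if "p \<in> W" for p
    using that chart_inv_image_eq[OF D(1) order_trans[OF ball_subset_cball ball_rng]]
    unfolding W_def by blast
  have move: "norm (chart_map c (\<gamma> s) - x) \<le> len \<gamma> a s / l" if s: "s \<in> {a..b}" "\<And>s'. s' \<in> {a..s} \<Longrightarrow> \<gamma> s' \<in> W" for s
  proof -
    have "\<gamma> s' \<in> chart_dom c \<and> chart_map c (\<gamma> s') \<in> K" if "s' \<in> {a..s}" for s'
      using W[OF s(2)[OF that]] \<rho>(1) ball_subset_cball by blast
    then show ?thesis using chart_displacement[OF K, of \<gamma> a s] pw_split[OF \<gamma> s(1)] start(2) by blast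
  qed
  have in_Q: "\<gamma> s \<in> Q" if s: "s \<in> {a..b}" "\<And>s'. s' \<in> {a..s} \<Longrightarrow> \<gamma> s' \<in> W" for s
  proof -
    have "len \<gamma> a s / l \<le> r" unfolding r_def using len_mono[OF \<gamma> s(1)] D(3) by (simp add: divide_right_mono)
    then have "chart_map c (\<gamma> s) \<in> cball x r" using move[OF s] by (simp add: dist_norm norm_minus_commute)
    moreover have "\<gamma> s \<in> chart_dom c" using W s by simp
    ultimately show ?thesis unfolding Q_def using D(1) by (metis chart_inv_map image_eqI)
  qed
  have "\<gamma> a \<in> W" unfolding W_def using start D(1) r by (metis centre_in_ball chart_inv_map image_eqI le_less_trans)
  have all: "\<gamma> s \<in> W" if "s \<in> {a..b}" for s
  proof (rule ccontr)
    assume bad: "\<gamma> s \<notin> W"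
    define Z where "Z = {a..b} \<inter> \<gamma> -` (- W)"
    have "closed Z" unfolding Z_def
      using continuous_closed_preimage[OF cont closed_real_atLeastAtMost] \<open>open W\<close> by blast
    moreover have "Z \<noteq> {}" "bdd_below Z" using bad that by (auto simp: Z_def bdd_below_def)
    ultimately have e: "Inf Z \<in> Z" by (intro closed_contains_Inf)
    define e where "e = Inf Z"
    have e: "e \<in> {a..b}" "\<gamma> e \<notin> W" using e by (auto simp: Z_def e_def)
    have before: "\<gamma> s' \<in> W" if "s' \<in> {a..<e}" for s'
      using that e(1) cInf_lower[OF _ \<open>bdd_below Z\<close>, of s'] by (force simp: Z_def e_def)
    have "a < e" using e \<open>\<gamma> a \<in> W\<close> by (cases "a = e") auto
    have "{a..<e} \<subseteq> {a..b} \<inter> \<gamma> -` Q" using in_Q before e(1) by auto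
    moreover have "closed ({a..b} \<inter> \<gamma> -` Q)"
      by (rule continuous_closed_preimage[OF cont closed_real_atLeastAtMost \<open>closed Q\<close>])
    ultimately have "closure {a..<e} \<subseteq> {a..b} \<inter> \<gamma> -` Q" by (rule closure_minimal)
    moreover have "e \<in> closure {a..<e}" using \<open>a < e\<close> by simp
    ultimately have "\<gamma> e \<in> Q" by blast
    then show False using e(2) \<open>Q \<subseteq> W\<close> by blast
  qed
  show "\<gamma> t \<in> chart_dom c" using W all t by blast
  show "norm (chart_map c (\<gamma> t) - x) \<le> len \<gamma> a t / l" using move[OF t] all t by simp
qed

lemma len_has_derivative:
  assumes \<gamma>: "C1_curve A \<gamma> a b" and t: "t \<in> {a..b}"
  shows "((\<lambda>t. len \<gamma> a t) has_vector_derivative speed \<gamma> a b t) (at t within {a..b})"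
proof (rule has_vector_derivative_transform[OF t])
  fix s assume s: "s \<in> {a..b}"
  show "len \<gamma> a s = integral {a..s} (speed \<gamma> a b)"
    unfolding len_eq
    by (rule integral_spike[of "{a, s}"]) (use s speed_interior[of _ a s a b] in auto)
next
  show "((\<lambda>s. integral {a..s} (speed \<gamma> a b)) has_vector_derivative speed \<gamma> a b t) (at t within {a..b})"
    by (rule integral_has_vector_derivative[OF continuous_on_speed[OF \<gamma>] t])
qed

section \<open>Perturbation of curves\<close>

text \<open>The curve shifted by \<open>h\<close> at its start, with a weight that fades out when the length reaches \<open>T\<close>. The
  weight depends on the arc length rather than on the parameter because the curve may stop, in which
  case it has no smooth unit speed parametrization.\<close>

definition shifted :: "('m, 'e) chart \<Rightarrow> (real \<Rightarrow> 'm) \<Rightarrow> real \<Rightarrow> real \<Rightarrow> 'e \<Rightarrow> real \<Rightarrow> 'm" where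
  "shifted c \<gamma> a T h = chart_inv c \<circ> (\<lambda>t. chart_map c (\<gamma> t) + (1 - len \<gamma> a t / T) *\<^sub>R h)"

lemma shifted_C1_curve:
  assumes K: "controlled c K l L B" and \<gamma>: "pw \<gamma> a m" "C1_curve A \<gamma> m b"
    and dom: "\<And>t. t \<in> {m..b} \<Longrightarrow> \<gamma> t \<in> chart_dom c"
    and K': "\<And>t. t \<in> {m..b} \<Longrightarrow> chart_map c (\<gamma> t) + (1 - len \<gamma> a t / T) *\<^sub>R h \<in> K"
  shows "C1_curve A (shifted c \<gamma> a T h) m b" (is ?C)
    "len (shifted c \<gamma> a T h) m b = integral {m..b} (\<lambda>t.
      F c (chart_map c (\<gamma> t) + (1 - len \<gamma> a t / T) *\<^sub>R h)
        (chart_velocity c \<gamma> m b t - (speed \<gamma> m b t * (1 / T)) *\<^sub>R h))" (is ?L)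
    "(\<lambda>t. F c (chart_map c (\<gamma> t) + (1 - len \<gamma> a t / T) *\<^sub>R h)
        (chart_velocity c \<gamma> m b t - (speed \<gamma> m b t * (1 / T)) *\<^sub>R h)) integrable_on {m..b}" (is ?I)
proof -
  note D = controlledD[OF K]
  let ?\<kappa> = "\<lambda>t. chart_map c (\<gamma> t) + (1 - len \<gamma> a t / T) *\<^sub>R h"
  let ?D = "\<lambda>t. chart_velocity c \<gamma> m b t - (speed \<gamma> m b t * (1 / T)) *\<^sub>R h"
  have mb: "m < b" using \<gamma>(2) by (auto simp: C1_curve_def)
  have len: "len \<gamma> a t = len \<gamma> a m + len \<gamma> m t" if "t \<in> {m..b}" for t
    using len_add[OF \<gamma>(1)] pw_split[OF pw_C1[OF \<gamma>(2)] that] by blast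
  have der: "(?\<kappa> has_vector_derivative ?D t) (at t within {m..b})" if t: "t \<in> {m..b}" for t
  proof -
    have 1: "((\<lambda>t. chart_map c (\<gamma> t)) has_vector_derivative chart_velocity c \<gamma> m b t) (at t within {m..b})"
      using C1_curve_chart_derivative[OF \<gamma>(2) D(1) t dom[OF t]] by (simp only: o_def)
    have "((\<lambda>t. len \<gamma> a m + len \<gamma> m t) has_vector_derivative 0 + speed \<gamma> m b t) (at t within {m..b})"
      by (intro has_vector_derivative_add has_vector_derivative_const len_has_derivative[OF \<gamma>(2) t])
    then have "((\<lambda>t. len \<gamma> a t) has_real_derivative speed \<gamma> m b t) (at t within {m..b})"
      using has_vector_derivative_transform[OF t len]
      by (simp add: has_real_derivative_iff_has_vector_derivative)
    then have "((\<lambda>t. 1 - len \<gamma> a t / T) has_real_derivative - (speed \<gamma> m b t * (1 / T))) (at t within {m..b})"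
      using DERIV_diff[OF DERIV_const[of 1] DERIV_cdivide] by fastforce
    then have "((\<lambda>t. (1 - len \<gamma> a t / T) *\<^sub>R h) has_vector_derivative
        (1 - len \<gamma> a t / T) *\<^sub>R 0 + (- (speed \<gamma> m b t * (1 / T))) *\<^sub>R h) (at t within {m..b})"
      by (intro has_vector_derivative_scaleR has_vector_derivative_const)
    from has_vector_derivative_add[OF 1 this] show ?thesis by simp
  qed
  have contD: "continuous_on {m..b} ?D"
  proof (intro continuous_intros continuous_on_speed[OF \<gamma>(2)])
    have "{t \<in> {m..b}. \<gamma> t \<in> chart_dom c} = {m..b}" using dom by blast
    then show "continuous_on {m..b} (chart_velocity c \<gamma> m b)"
      using \<gamma>(2) D(1) unfolding C1_curve_def by metis
  qed
  have rng: "?\<kappa> t \<in> chart_range c" if "t \<in> {m..b}" for t using K'[OF that] D(2) by blast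
  show ?C unfolding shifted_def by (rule C1_curve_from_chart(1)[OF D(1) mb rng der contD])
  show ?L unfolding shifted_def by (rule C1_curve_from_chart(2)[OF D(1) mb rng der contD])
  have "continuous_on {m..b} ?\<kappa>"
    using der has_vector_derivative_continuous continuous_on_eq_continuous_within by blast
  then show ?I using rng by (intro integrable_continuous_real continuous_on_F D(1) contD) auto
qed

text \<open>The pointwise estimate \<open>F_second_difference\<close> with \<open>\<beta> = 1 / T\<close>, integrated over each smooth piece.\<close>

lemma shifted_curves_length:
  assumes K: "controlled c K l L B" and T: "T > 0" and \<gamma>: "pw \<gamma> a b" and "len \<gamma> a b \<le> T"
    and "\<And>t. t \<in> {a..b} \<Longrightarrow> \<gamma> t \<in> chart_dom c"
    and "\<And>t r. t \<in> {a..b} \<Longrightarrow> \<bar>r\<bar> \<le> 1 \<Longrightarrow> chart_map c (\<gamma> t) + r *\<^sub>R h \<in> K"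
  defines "C \<equiv> (B / l\<^sup>2 + 4 * (1 / T) * B / l + 2 * (1 / T)\<^sup>2 * L\<^sup>2) / 2"
  shows "pw (shifted c \<gamma> a T h) a b \<and> pw (shifted c \<gamma> a T (- h)) a b \<and>
    len (shifted c \<gamma> a T h) a b + len (shifted c \<gamma> a T (- h)) a b
      \<le> (2 + C * (norm h)\<^sup>2) * len \<gamma> a b"
  using \<gamma> assms(4-6)
proof (induction rule: pw_induct)
  case refl
  then show ?case by (simp add: pw_refl len_refl)
next
  case (snoc m b)
  note D = controlledD[OF K]
  have mb: "a \<le> m" "m < b" using snoc.hyps pw_le by (auto simp: C1_curve_def)
  have ab: "pw \<gamma> a b" using snoc.hyps pw_snoc by blast
  let ?k = "2 + C * (norm h)\<^sup>2" and ?p = "shifted c \<gamma> a T h" and ?n = "shifted c \<gamma> a T (- h)"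
  have IH: "pw ?p a m" "pw ?n a m" "len ?p a m + len ?n a m \<le> ?k * len \<gamma> a m"
    using snoc.IH snoc.prems mb len_mono[OF ab, of m] by auto
  have dom: "\<gamma> t \<in> chart_dom c" if "t \<in> {m..b}" for t using snoc.prems(2) mb that by auto
  define \<alpha> where "\<alpha> t = 1 - len \<gamma> a t / T" for t
  have \<alpha>: "0 \<le> \<alpha> t" "\<alpha> t \<le> 1" if "t \<in> {m..b}" for t
  proof -
    have "t \<in> {a..b}" using that mb by auto
    then have "0 \<le> len \<gamma> a t" "len \<gamma> a t \<le> T"
      using len_nonneg pw_split[OF ab] order_trans[OF len_mono[OF ab] snoc.prems(1)] by blast+
    then show "0 \<le> \<alpha> t" "\<alpha> t \<le> 1" using T by (auto simp: \<alpha>_def field_simps)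
  qed
  have in_K: "chart_map c (\<gamma> t) + r *\<^sub>R h \<in> K" if "t \<in> {m..b}" "\<bar>r\<bar> \<le> 1" for t r
    using snoc.prems(3) that mb by auto
  have Kp: "chart_map c (\<gamma> t) + (1 - len \<gamma> a t / T) *\<^sub>R h \<in> K" if "t \<in> {m..b}" for t
    using in_K[OF that, of "\<alpha> t"] \<alpha>[OF that] by (simp add: \<alpha>_def)
  have Kn: "chart_map c (\<gamma> t) + (1 - len \<gamma> a t / T) *\<^sub>R (- h) \<in> K" if "t \<in> {m..b}" for t
  proof -
    have "chart_map c (\<gamma> t) + (- \<alpha> t) *\<^sub>R h \<in> K" using \<alpha>[OF that] by (intro in_K[OF that]) simp
    then show ?thesis by (simp only: \<alpha>_def scaleR_minus_left scaleR_minus_right)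
  qed
  let ?fp = "\<lambda>t. F c (chart_map c (\<gamma> t) + (1 - len \<gamma> a t / T) *\<^sub>R h)
    (chart_velocity c \<gamma> m b t - (speed \<gamma> m b t * (1 / T)) *\<^sub>R h)"
  let ?fn = "\<lambda>t. F c (chart_map c (\<gamma> t) + (1 - len \<gamma> a t / T) *\<^sub>R (- h))
    (chart_velocity c \<gamma> m b t - (speed \<gamma> m b t * (1 / T)) *\<^sub>R (- h))"
  have p: "C1_curve A ?p m b" "len ?p m b = integral {m..b} ?fp" "?fp integrable_on {m..b}"
    by (rule shifted_C1_curve[OF K snoc.hyps dom Kp]; assumption)+
  have n: "C1_curve A ?n m b" "len ?n m b = integral {m..b} ?fn" "?fn integrable_on {m..b}"
    by (rule shifted_C1_curve[OF K snoc.hyps dom Kn]; assumption)+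
  have "len ?p m b + len ?n m b \<le> ?k * len \<gamma> m b"
  proof -
    have "len ?p m b + len ?n m b = integral {m..b} (\<lambda>t. ?fp t + ?fn t)"
      unfolding p(2) n(2) by (rule integral_add[OF p(3) n(3), symmetric])
    also have "\<dots> \<le> integral {m..b} (\<lambda>t. ?k * speed \<gamma> m b t)"
    proof (rule integral_le)
      show "(\<lambda>t. ?k * speed \<gamma> m b t) integrable_on {m..b}"
        using integrable_cmul[OF C1_integrable[OF snoc.hyps(2)], of ?k] by simp
      fix t assume t: "t \<in> {m..b}"
      have xK: "chart_map c (\<gamma> t) \<in> K" "chart_map c (\<gamma> t) + \<alpha> t *\<^sub>R h \<in> K"
        "chart_map c (\<gamma> t) - \<alpha> t *\<^sub>R h \<in> K"
        using in_K[OF t, of 0] Kp[OF t] Kn[OF t] by (auto simp: \<alpha>_def)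
      have sp: "speed \<gamma> m b t = F c (chart_map c (\<gamma> t)) (chart_velocity c \<gamma> m b t)"
        by (rule speed_eq_F[OF snoc.hyps(2) t D(1) dom[OF t]])
      have "F c (chart_map c (\<gamma> t) + \<alpha> t *\<^sub>R h) (chart_velocity c \<gamma> m b t - (speed \<gamma> m b t * (1 / T)) *\<^sub>R h) +
          F c (chart_map c (\<gamma> t) - \<alpha> t *\<^sub>R h) (chart_velocity c \<gamma> m b t + (speed \<gamma> m b t * (1 / T)) *\<^sub>R h)
          \<le> speed \<gamma> m b t * ?k"
        unfolding sp C_def using T by (intro F_second_difference[OF K _ \<alpha>[OF t] xK]) simp
      then show "?fp t + ?fn t \<le> ?k * speed \<gamma> m b t"
        by (simp only: \<alpha>_def scaleR_minus_right diff_minus_eq_add add_uminus_conv_diff mult.commute)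
    qed (rule integrable_add[OF p(3) n(3)])
    also have "\<dots> = ?k * len \<gamma> m b" by (simp add: len_eq)
    finally show ?thesis .
  qed
  then show ?case
    using IH pw_snoc[OF IH(1) p(1)] pw_snoc[OF IH(2) n(1)] len_snoc[OF IH(1) p(1)]
      len_snoc[OF IH(2) n(1)] len_snoc[OF snoc.hyps]
    by (simp add: distrib_left)
qed

section \<open>Functions with steepest descent\<close>

definition nonexpansive :: "('m \<Rightarrow> real) \<Rightarrow> bool" where
  "nonexpansive u \<longleftrightarrow> (\<forall>\<gamma> a b. pw \<gamma> a b \<longrightarrow> u (\<gamma> a) \<le> u (\<gamma> b) + len \<gamma> a b)"

definition steepest_descent :: "('m \<Rightarrow> real) \<Rightarrow> bool" where
  "steepest_descent u \<longleftrightarrow> (\<forall>x r \<delta>. 0 < r \<longrightarrow> 0 < \<delta> \<longrightarrow>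
     (\<exists>\<gamma> a b. pw \<gamma> a b \<and> \<gamma> a = x \<and> len \<gamma> a b = r \<and> u (\<gamma> b) \<le> u x - r + \<delta>))"

lemma nonexpansive_Lipschitz_in_chart:
  assumes u: "nonexpansive u" and K: "controlled c K l L B" "convex K" and xy: "x \<in> K" "y \<in> K"
  shows "u (chart_inv c x) - u (chart_inv c y) \<le> L * norm (x - y)"
proof -
  note D = controlledD[OF K(1)]
  obtain \<gamma> where "pw \<gamma> 0 1" "\<gamma> 0 = chart_inv c x" "\<gamma> 1 = chart_inv c y" "len \<gamma> 0 1 \<le> L * norm (y - x)"
    using segment_curve[OF D(1) K(2) D(2) xy, of "L * norm (y - x)"] D(7) by blast
  then show ?thesis using u unfolding nonexpansive_def by (smt (verit) norm_minus_commute)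
qed

lemma nonexpansive_continuous:
  assumes u: "nonexpansive u" shows "continuous_on UNIV u"
proof -
  have "isCont u x" for x
  proof -
    obtain c where c: "c \<in> A" "x \<in> chart_dom c" using exists_chart charts_at_iff by blast
    let ?z = "chart_map c x"
    have z: "?z \<in> chart_range c" using c by blast
    obtain R l L B where K: "R > 0" "controlled c (cball ?z R) l L B"
      using exists_controlled_ball[OF c(1) z] by blast
    note D = controlledD[OF K(2)]
    define W where "W = chart_inv c ` ball ?z R"
    have sub: "ball ?z R \<subseteq> chart_range c" using D(2) ball_subset_cball by blast
    have "open W" unfolding W_def by (rule open_chart_inv_image[OF c(1) open_ball sub])
    have "x \<in> W" unfolding W_def using c K(1) by (metis centre_in_ball chart_inv_map image_eqI)
    have W: "W = chart_dom c \<inter> chart_map c -` ball ?z R"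
      unfolding W_def by (rule chart_inv_image_eq[OF c(1) sub])
    have "L-lipschitz_on (ball ?z R) (\<lambda>y. u (chart_inv c y))"
    proof (rule lipschitz_onI)
      fix y y' assume yy: "y \<in> ball ?z R" "y' \<in> ball ?z R"
      then have "y \<in> cball ?z R" "y' \<in> cball ?z R" by auto
      then show "dist (u (chart_inv c y)) (u (chart_inv c y')) \<le> L * dist y y'"
        using nonexpansive_Lipschitz_in_chart[OF u K(2) convex_cball, of y y']
          nonexpansive_Lipschitz_in_chart[OF u K(2) convex_cball, of y' y]
        by (simp add: dist_norm abs_le_iff norm_minus_commute)
    qed (use D(4) in simp)
    then have "continuous_on (ball ?z R) (\<lambda>y. u (chart_inv c y))" by (rule lipschitz_on_continuous_on)
    then have "continuous_on W (\<lambda>p. u (chart_inv c (chart_map c p)))"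
      by (rule continuous_on_compose2)
        (use W continuous_on_subset[OF continuous_on_chart_map[OF c(1)]] in auto)
    then have "continuous_on W u" by (rule continuous_on_eq) (use W c(1) in auto)
    then show ?thesis using \<open>open W\<close> \<open>x \<in> W\<close> continuous_on_eq_continuous_at by blast
  qed
  then show ?thesis by (simp add: continuous_at_imp_continuous_on)
qed

text \<open>Along the segment from \<open>x\<close> in direction \<open>t v\<close> the function \<open>u\<close>, and hence the test function above
  it, drops by at most \<open>t\<close> times the norm of \<open>v\<close>, up to terms of higher order in \<open>t\<close>.\<close>

lemma touching_above:
  assumes u: "nonexpansive u" and c: "c \<in> A" "x \<in> chart_dom c"
    and \<phi>: "((\<phi> \<circ> chart_inv c) has_derivative \<xi>) (at (chart_map c x))"
    and touch: "\<forall>\<^sub>F y in nhds x. u y - \<phi> y \<le> u x - \<phi> x"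
  shows "- \<xi> v \<le> F c (chart_map c x) v"
proof (cases "v = 0")
  case True
  then show ?thesis using linear_0[OF has_derivative_linear[OF \<phi>]] F_zero c by simp
next
  case False
  let ?z = "chart_map c x"
  have z: "?z \<in> chart_range c" using c by blast
  obtain R l L B where K: "R > 0" "controlled c (cball ?z R) l L B"
    using exists_controlled_ball[OF c(1) z] by blast
  note D = controlledD[OF K(2)]
  obtain d where d: "d > 0" "\<And>y. y \<in> ball ?z d \<Longrightarrow>
      u (chart_inv c y) - \<phi> (chart_inv c y) \<le> u x - \<phi> x"
    using eventually_in_chart[OF c touch] by metis
  let ?k = "norm v + B / l\<^sup>2 * norm v * F c ?z v"
  show ?thesis
  proof (rule le_if_le_add_epsilon_mult[of _ _ ?k])
    fix e :: real assume e: "0 < e" "e < 1"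
    obtain d' where d': "d' > 0" "\<And>y. norm (y - ?z) < d' \<Longrightarrow>
        \<bar>\<phi> (chart_inv c y) - \<phi> (chart_inv c ?z) - \<xi> (y - ?z)\<bar> \<le> e * norm (y - ?z)"
      using \<phi> e(1) unfolding has_derivative_at_alt by (auto simp: o_def)
    define t where "t = min e (min (min R d) d' / (2 * norm v))"
    have t: "0 < t" "t \<le> e" "t \<le> min (min R d) d' / (2 * norm v)"
      using K(1) d(1) d'(1) e False by (auto simp: t_def)
    have "t * norm v \<le> min (min R d) d' / 2" using t(3) False by (simp add: field_simps)
    then have tv: "t * norm v \<le> R" "t * norm v < d" "t * norm v < d'"
      using K(1) d(1) d'(1) by linarith+
    let ?y = "?z + t *\<^sub>R v"
    have "u (chart_inv c ?z) \<le> u (chart_inv c ?y) + (1 + B / l\<^sup>2 * (t * norm v)) * (t * F c ?z v)"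
    proof -
      have W: "cball ?z (t * norm v) \<subseteq> cball ?z R" using tv(1) by auto
      have bound: "F c w (?y - ?z) \<le> (1 + B / l\<^sup>2 * (t * norm v)) * (t * F c ?z v)"
        if w: "w \<in> cball ?z (t * norm v)" for w
      proof -
        have wR: "w \<in> cball ?z R" using w W by blast
        have "F c w (t *\<^sub>R v) \<le> (1 + B / l\<^sup>2 * norm (w - ?z)) * F c ?z (t *\<^sub>R v)"
          using F_compare[OF K(2) wR, of ?z "t *\<^sub>R v"] K(1) by simp
        also have "\<dots> \<le> (1 + B / l\<^sup>2 * (t * norm v)) * F c ?z (t *\<^sub>R v)"
          using w D(5) F_nonneg[OF c(1) z]
          by (intro mult_right_mono add_left_mono mult_left_mono) (auto simp: dist_norm norm_minus_commute)
        finally show ?thesis using F_scaleR[OF c(1) z, of t v] t(1) by simp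
      qed
      have ends: "?z \<in> cball ?z (t * norm v)" "?y \<in> cball ?z (t * norm v)"
        using t(1) by (simp_all add: dist_norm)
      obtain \<gamma> where "pw \<gamma> 0 1" "\<gamma> 0 = chart_inv c ?z" "\<gamma> 1 = chart_inv c ?y"
        "len \<gamma> 0 1 \<le> (1 + B / l\<^sup>2 * (t * norm v)) * (t * F c ?z v)"
        by (rule segment_curve[OF c(1) convex_cball order_trans[OF W D(2)] ends bound])
      then show ?thesis using u unfolding nonexpansive_def by (smt (verit))
    qed
    moreover have "u (chart_inv c ?y) - \<phi> (chart_inv c ?y) \<le> u x - \<phi> x"
      by (rule d(2)) (use tv t in \<open>simp add: dist_norm\<close>)
    moreover have "\<phi> (chart_inv c ?y) - \<phi> (chart_inv c ?z) \<le> t * \<xi> v + e * (t * norm v)"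
      using d'(2)[of ?y] tv(3) t(1) linear_scale[OF has_derivative_linear[OF \<phi>], of t v] by simp
    ultimately have "t * (- \<xi> v) \<le> t * (e * norm v + (1 + B / l\<^sup>2 * (t * norm v)) * F c ?z v)"
      using c by (simp add: algebra_simps)
    then have "- \<xi> v \<le> e * norm v + (1 + B / l\<^sup>2 * (t * norm v)) * F c ?z v"
      using t(1) by (simp only: mult_le_cancel_left_pos)
    also have "\<dots> \<le> e * norm v + (1 + B / l\<^sup>2 * (e * norm v)) * F c ?z v"
      using t(2) D(5) F_nonneg[OF c(1) z]
      by (intro add_left_mono mult_right_mono mult_left_mono) auto
    finally show "- \<xi> v \<le> F c ?z v + e * ?k" by (simp add: algebra_simps)
  qed
qed

text \<open>Along a descent curve of length \<open>r\<close> the test function drops by at least \<open>r - e r\<close>, while its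
  linearization drops by at most \<open>N (1 + e) r\<close>. The permitted error in the descent is chosen
  proportional to \<open>r\<close>, so that it disappears after division by \<open>r\<close>.\<close>

lemma touching_below:
  assumes u: "steepest_descent u" and c: "c \<in> A" "x \<in> chart_dom c"
    and \<phi>: "((\<phi> \<circ> chart_inv c) has_derivative \<xi>) (at (chart_map c x))"
    and touch: "\<forall>\<^sub>F y in nhds x. u y - \<phi> y \<ge> u x - \<phi> x"
    and N: "0 \<le> N" "\<And>v. \<bar>\<xi> v\<bar> \<le> N * F c (chart_map c x) v"
  shows "1 \<le> N"
proof -
  let ?z = "chart_map c x"
  have z: "?z \<in> chart_range c" using c by blast
  obtain R l L B where K: "R > 0" "controlled c (cball ?z R) l L B"
    using exists_controlled_ball[OF c(1) z] by blast
  note D = controlledD[OF K(2)]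
  obtain d where d: "d > 0" "\<And>y. y \<in> ball ?z d \<Longrightarrow>
      u (chart_inv c y) - \<phi> (chart_inv c y) \<ge> u x - \<phi> x"
    using eventually_in_chart[OF c touch] by metis
  show ?thesis
  proof (rule le_if_le_add_epsilon_mult[of _ _ "1 + N + 1 / l"])
    fix e :: real assume e: "0 < e" "e < 1"
    obtain d' where d': "d' > 0" "\<And>y. norm (y - ?z) < d' \<Longrightarrow>
        \<bar>\<phi> (chart_inv c y) - \<phi> (chart_inv c ?z) - \<xi> (y - ?z)\<bar> \<le> e * norm (y - ?z)"
      using \<phi> e(1) unfolding has_derivative_at_alt by (auto simp: o_def)
    \<comment> \<open>the last bound makes the comparison factor of \<open>F_compare\<close> at most \<open>1 + e\<close>\<close>
    define \<rho> where "\<rho> = min (min R (min d d')) (e / (B / l\<^sup>2 + 1))"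
    have Bl: "0 \<le> B / l\<^sup>2" using D(5) by simp
    have \<rho>: "0 < \<rho>" "\<rho> \<le> R" "\<rho> \<le> d" "\<rho> \<le> d'" "\<rho> \<le> e / (B / l\<^sup>2 + 1)"
      using K(1) d(1) d'(1) e Bl by (auto simp: \<rho>_def add_nonneg_pos)
    have "B / l\<^sup>2 * \<rho> \<le> (B / l\<^sup>2 + 1) * \<rho>" using \<rho>(1) by (intro mult_right_mono) auto
    also have "\<dots> \<le> e" using \<rho>(5) Bl by (simp add: pos_le_divide_eq add_nonneg_pos mult.commute)
    finally have Be: "B / l\<^sup>2 * \<rho> \<le> e" .
    define r where "r = l * \<rho> / 2"
    have r: "0 < r" "r < l * \<rho>" "r / l = \<rho> / 2" using D(3) \<rho>(1) by (auto simp: r_def)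
    obtain \<gamma> a b where \<gamma>: "pw \<gamma> a b" "\<gamma> a = x" "len \<gamma> a b = r" "u (\<gamma> b) \<le> u x - r + e * r"
      using u r(1) e(1) unfolding steepest_descent_def by (meson mult_pos_pos)
    have dom: "\<gamma> t \<in> chart_dom c" "norm (chart_map c (\<gamma> t) - ?z) \<le> \<rho> / 2" if t: "t \<in> {a..b}" for t
    proof -
      have st: "\<gamma> a \<in> chart_dom c" "chart_map c (\<gamma> a) = ?z" "cball ?z \<rho> \<subseteq> cball ?z R" "len \<gamma> a b < l * \<rho>"
        using \<gamma> c(2) \<rho>(2) r(2) by auto
      note S = short_curve_stays_in_chart[OF K(2) \<gamma>(1) st t]
      show "\<gamma> t \<in> chart_dom c" by (rule S(1))
      have "len \<gamma> a t / l \<le> r / l" using len_mono[OF \<gamma>(1) t] \<gamma>(3) D(3) by (simp add: divide_right_mono)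
      then show "norm (chart_map c (\<gamma> t) - ?z) \<le> \<rho> / 2" unfolding r(3) by (rule order_trans[OF S(2)])
    qed
    let ?y = "chart_map c (\<gamma> b)"
    have b: "b \<in> {a..b}" using pw_le[OF \<gamma>(1)] by simp
    have inv: "chart_inv c ?y = \<gamma> b" "chart_inv c ?z = x" using c dom(1)[OF b] by auto
    have "- \<xi> (?y - chart_map c (\<gamma> a)) \<le> (N * (1 + e)) * len \<gamma> a b"
    proof (rule linear_along_curve[OF \<gamma>(1) c(1) _ dom(1)])
      show "linear (\<lambda>v. - \<xi> v)" using has_derivative_linear[OF \<phi>] by (rule linear_compose_neg)
      fix t v assume t: "t \<in> {a..b}"
      let ?w = "chart_map c (\<gamma> t)"
      have w: "?w \<in> cball ?z R" "norm (?z - ?w) \<le> \<rho>"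
        using dom(2)[OF t] \<rho>(1,2) by (auto simp: dist_norm norm_minus_commute)
      have wr: "?w \<in> chart_range c" using dom(1)[OF t] by blast
      have "F c ?z v \<le> (1 + B / l\<^sup>2 * norm (?z - ?w)) * F c ?w v"
        using F_compare[OF K(2) _ w(1), of ?z v] K(1) by simp
      also have "\<dots> \<le> (1 + e) * F c ?w v"
        using mult_left_mono[OF w(2) Bl] Be by (intro mult_right_mono F_nonneg c(1) wr) auto
      finally have "N * F c ?z v \<le> N * ((1 + e) * F c ?w v)" by (rule mult_left_mono[OF _ N(1)])
      then show "- \<xi> v \<le> N * (1 + e) * F c ?w v" using N(2)[of v] by (simp add: mult.assoc)
    qed
    then have lin: "- \<xi> (?y - ?z) \<le> N * (1 + e) * r" using \<gamma>(2,3) by simp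
    have near: "norm (?y - ?z) \<le> \<rho> / 2" by (rule dom(2)[OF b])
    have "u (\<gamma> b) - \<phi> (\<gamma> b) \<ge> u x - \<phi> x"
      using d(2)[of ?y] near \<rho>(1,3) inv by (simp add: dist_norm norm_minus_commute)
    moreover have "\<bar>\<phi> (\<gamma> b) - \<phi> x - \<xi> (?y - ?z)\<bar> \<le> e * norm (?y - ?z)"
      using d'(2)[of ?y] near \<rho>(1,4) inv by simp
    moreover have "e * norm (?y - ?z) \<le> e * (r / l)" 
      by (rule mult_left_mono[OF near[folded r(3)]]) (use e(1) in simp)
    ultimately have "r - e * r \<le> N * (1 + e) * r + e * (r / l)" using \<gamma>(4) lin by linarith
    then have "r * 1 \<le> r * (N + e * (1 + N + 1 / l))" by (simp add: algebra_simps)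
    then show "1 \<le> N + e * (1 + N + 1 / l)" using r(1) by (simp only: mult_le_cancel_left_pos)
  qed
qed

lemma test_function_norms:
  assumes \<phi>: "C1_on A \<phi> N" "x \<in> N"
  obtains c \<xi> n where "c \<in> A" "x \<in> chart_dom c"
    "((\<phi> \<circ> chart_inv c) has_derivative \<xi>) (at (chart_map c x))" "0 \<le> n"
    "tangent_norm g x (gradient A g \<phi> x) = n" "cotangent_norm A g x (differential A \<phi> x) = n"
    "\<And>v. \<bar>\<xi> v\<bar> \<le> n * F c (chart_map c x) v"
    "(\<And>v. \<bar>\<xi> v\<bar> \<le> F c (chart_map c x) v) \<Longrightarrow> n \<le> 1"
proof -
  define c where "c = (SOME c. c \<in> charts_at A x)"
  have "c \<in> charts_at A x" unfolding c_def using exists_chart someI_ex by metis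
  then have c: "c \<in> A" "x \<in> chart_dom c" by (auto simp: charts_at_iff)
  define \<xi> where "\<xi> = frechet_derivative (\<phi> \<circ> chart_inv c) (at (chart_map c x))"
  have "C_k_on (Suc 0) (\<phi> \<circ> chart_inv c) (overlap c N)" using \<phi>(1) c(1) unfolding C1_on_def by simp
  then have "(\<phi> \<circ> chart_inv c) differentiable (at (chart_map c x))" using \<phi>(2) c(2) by auto
  then have der: "((\<phi> \<circ> chart_inv c) has_derivative \<xi>) (at (chart_map c x))"
    unfolding \<xi>_def by (simp only: frechet_derivative_works)
  have lin: "linear \<xi>" by (rule has_derivative_linear[OF der])
  obtain n where n: "0 \<le> n" "tangent_norm g x (gradient A g \<phi> x) = n"
    "cotangent_norm A g x (differential A \<phi> x) = n" "\<And>v. \<bar>\<xi> v\<bar> \<le> n * F c (chart_map c x) v"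
    "(\<And>v. \<bar>\<xi> v\<bar> \<le> F c (chart_map c x) v) \<Longrightarrow> n \<le> 1"
    using gradient_norm[of \<phi> x] lin unfolding \<xi>_def c_def by metis
  show ?thesis by (rule that[OF c der n])
qed

lemma viscosity_gradient_iff_differential:
  "viscosity_solution_gradient A g u \<longleftrightarrow> viscosity_solution_differential A g u"
proof -
  have "(tangent_norm g x (gradient A g \<phi> x) \<le> 1 \<longleftrightarrow> (cotangent_norm A g x (differential A \<phi> x))\<^sup>2 \<le> 1) \<and>
      (tangent_norm g x (gradient A g \<phi> x) \<ge> 1 \<longleftrightarrow> (cotangent_norm A g x (differential A \<phi> x))\<^sup>2 \<ge> 1)"
    if \<phi>: "C1_on A \<phi> N" "x \<in> N" for \<phi> x N
  proof -
    obtain n where "0 \<le> n" "tangent_norm g x (gradient A g \<phi> x) = n"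
      "cotangent_norm A g x (differential A \<phi> x) = n"
      using test_function_norms[OF \<phi>] by metis
    then show ?thesis using abs_le_square_iff[of n 1] abs_le_square_iff[of 1 n] by simp
  qed
  then show ?thesis
    unfolding viscosity_solution_gradient_def viscosity_solution_differential_def
      viscosity_solution_def by meson
qed

lemma viscosity_solution_if_descent:
  assumes u: "nonexpansive u" "steepest_descent u"
  shows "viscosity_solution_gradient A g u"
  unfolding viscosity_solution_gradient_def viscosity_solution_def
proof (intro conjI allI impI nonexpansive_continuous[OF u(1)]; elim conjE)
  fix x \<phi> N assume \<phi>: "x \<in> N" "C1_on A \<phi> N" and touch: "\<forall>\<^sub>F y in nhds x. u y - \<phi> y \<le> u x - \<phi> x"
  obtain c \<xi> n where c: "c \<in> A" "x \<in> chart_dom c"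
    "((\<phi> \<circ> chart_inv c) has_derivative \<xi>) (at (chart_map c x))"
    and n: "tangent_norm g x (gradient A g \<phi> x) = n"
      "(\<And>v. \<bar>\<xi> v\<bar> \<le> F c (chart_map c x) v) \<Longrightarrow> n \<le> 1"
    using test_function_norms[OF \<phi>(2,1)] by metis
  have "\<bar>\<xi> v\<bar> \<le> F c (chart_map c x) v" for v
    using touching_above[OF u(1) c touch, of v] touching_above[OF u(1) c touch, of "- v"]
      F_scaleR[of c "chart_map c x" "- 1" v] c linear_neg[OF has_derivative_linear[OF c(3)], of v]
    by simp
  then show "tangent_norm g x (gradient A g \<phi> x) \<le> 1" using n by blast
next
  fix x \<phi> N assume \<phi>: "x \<in> N" "C1_on A \<phi> N" and touch: "\<forall>\<^sub>F y in nhds x. u y - \<phi> y \<ge> u x - \<phi> x"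
  obtain c \<xi> n where c: "c \<in> A" "x \<in> chart_dom c"
    "((\<phi> \<circ> chart_inv c) has_derivative \<xi>) (at (chart_map c x))"
    and n: "tangent_norm g x (gradient A g \<phi> x) = n" "0 \<le> n"
      "\<And>v. \<bar>\<xi> v\<bar> \<le> n * F c (chart_map c x) v"
    using test_function_norms[OF \<phi>(2,1)] by metis
  show "tangent_norm g x (gradient A g \<phi> x) \<ge> 1"
    using touching_below[OF u(2) c touch n(2,3)] n(1) by simp
qed

text \<open>Take the descent curve from \<open>x\<close> of length \<open>T = l R / 8\<close>. It moves by at most \<open>R / 8\<close> in the chart, so
  both shifted curves stay in the ball of radius \<open>R\<close> where the metric is controlled. They start at
  \<open>x + h\<close> and \<open>x - h\<close>, and end where the descent curve ends.\<close>

lemma local_second_difference: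
  assumes u: "nonexpansive u" "steepest_descent u" and c: "c \<in> A" and p: "p \<in> chart_range c"
  obtains d C where "d > 0"
    "\<And>x h. x \<in> ball p d \<Longrightarrow> norm h \<le> d \<Longrightarrow>
      u (chart_inv c (x + h)) + u (chart_inv c (x - h)) - 2 * u (chart_inv c x) \<le> C * (norm h)\<^sup>2"
proof -
  obtain R l L B where K: "R > 0" "controlled c (cball p R) l L B"
    using exists_controlled_ball[OF c p] by blast
  note D = controlledD[OF K(2)]
  define T where "T = l * R / 8"
  have T: "T > 0" "T < l * (R / 4)" "T / l = R / 8" using K(1) D(3) by (auto simp: T_def)
  define C where "C = (B / l\<^sup>2 + 4 * (1 / T) * B / l + 2 * (1 / T)\<^sup>2 * L\<^sup>2) / 2"
  have "u (chart_inv c (x + h)) + u (chart_inv c (x - h)) - 2 * u (chart_inv c x) \<le> C * T * (norm h)\<^sup>2"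
    if x: "x \<in> ball p (R / 4)" and h: "norm h \<le> R / 4" for x h
  proof (rule le_if_le_add_epsilon_mult[of _ _ 2])
    fix e :: real assume e: "0 < e"
    have xr: "x \<in> chart_range c" using x D(2) K(1) by auto
    obtain \<gamma> a b where \<gamma>: "pw \<gamma> a b" "\<gamma> a = chart_inv c x" "len \<gamma> a b = T"
      "u (\<gamma> b) \<le> u (chart_inv c x) - T + e"
      using u(2) T(1) e unfolding steepest_descent_def by blast
    have ab: "a \<le> b" by (rule pw_le[OF \<gamma>(1)])
    have st: "\<gamma> a \<in> chart_dom c" "chart_map c (\<gamma> a) = x" "len \<gamma> a b < l * (R / 4)"
      using \<gamma> c xr chart_inv_in_dom T(2) by auto
    have sub: "cball x (R / 4) \<subseteq> cball p R"
    proof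
      fix y assume "y \<in> cball x (R / 4)"
      then show "y \<in> cball p R" using x dist_triangle[of p y x] K(1) by auto
    qed
    have dom: "\<gamma> t \<in> chart_dom c" "norm (chart_map c (\<gamma> t) - x) \<le> R / 8" if t: "t \<in> {a..b}" for t
    proof -
      note S = short_curve_stays_in_chart[OF K(2) \<gamma>(1) st(1,2) sub st(3) t]
      show "\<gamma> t \<in> chart_dom c" by (rule S(1))
      have "len \<gamma> a t / l \<le> T / l" using len_mono[OF \<gamma>(1) t] \<gamma>(3) D(3) by (simp add: divide_right_mono)
      then show "norm (chart_map c (\<gamma> t) - x) \<le> R / 8" unfolding T(3) by (rule order_trans[OF S(2)])
    qed
    have in_K: "chart_map c (\<gamma> t) + r *\<^sub>R h \<in> cball p R" if t: "t \<in> {a..b}" and r: "\<bar>r\<bar> \<le> 1" for t r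
    proof -
      have "norm (r *\<^sub>R h) \<le> R / 4" using r h mult_mono[OF r h] by simp
      then have "norm ((chart_map c (\<gamma> t) - x) + r *\<^sub>R h + (x - p)) \<le> R / 8 + R / 4 + R / 4"
        using dom(2)[OF t] x by (intro norm_triangle_mono) (auto simp: dist_norm norm_minus_commute)
      then show ?thesis using K(1) by (simp add: dist_norm norm_minus_commute algebra_simps)
    qed
    let ?p = "shifted c \<gamma> a T h" and ?n = "shifted c \<gamma> a T (- h)"
    have S: "pw ?p a b" "pw ?n a b" "len ?p a b + len ?n a b \<le> (2 + C * (norm h)\<^sup>2) * T"
      using shifted_curves_length[OF K(2) T(1) \<gamma>(1) _ dom(1) in_K] \<gamma>(3) unfolding C_def by auto
    have ends: "?p a = chart_inv c (x + h)" "?n a = chart_inv c (x - h)" "?p b = \<gamma> b" "?n b = \<gamma> b"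
      using st(2) \<gamma>(3) T(1) c dom(1) ab by (auto simp: shifted_def len_refl)
    have "u (?p a) \<le> u (?p b) + len ?p a b" "u (?n a) \<le> u (?n b) + len ?n a b"
      using u(1) S(1,2) unfolding nonexpansive_def by blast+
    then have "u (chart_inv c (x + h)) + u (chart_inv c (x - h)) \<le> 2 * u (\<gamma> b) + (2 + C * (norm h)\<^sup>2) * T"
      using S(3) unfolding ends by linarith
    also have "\<dots> \<le> 2 * u (chart_inv c x) + C * T * (norm h)\<^sup>2 + e * 2"
      using \<gamma>(4) by (simp add: algebra_simps)
    finally show "u (chart_inv c (x + h)) + u (chart_inv c (x - h)) - 2 * u (chart_inv c x)
        \<le> C * T * (norm h)\<^sup>2 + e * 2" by simp
  qed
  then show ?thesis using that[of "R / 4" "C * T"] K(1) by simp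
qed

text \<open>The local constants are made uniform by a finite subcover of the compact closure; the parallelogram
  identity turns the bound on second differences into local midpoint concavity.\<close>

lemma locally_semiconcave_if_descent:
  assumes u: "nonexpansive u" "steepest_descent u" shows "locally_semiconcave A u"
  unfolding locally_semiconcave_def
proof (intro conjI allI nonexpansive_continuous[OF u(1)])
  fix x
  obtain c where c: "c \<in> A" "x \<in> chart_dom c" using exists_chart charts_at_iff by blast
  let ?f = "u \<circ> chart_inv c"
  have cont: "continuous_on (chart_range c) ?f"
    by (intro continuous_on_compose continuous_on_chart_inv[OF c(1)]
        continuous_on_subset[OF nonexpansive_continuous[OF u(1)]]) simp
  have "\<exists>C. concave_on S (\<lambda>y. ?f y - C / 2 * (norm y)\<^sup>2)"
    if S: "open S" "convex S" "compact (closure S)" "closure S \<subseteq> chart_range c" for S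
  proof -
    have "\<exists>d C. d > 0 \<and> (\<forall>y h. y \<in> ball p d \<longrightarrow> norm h \<le> d \<longrightarrow>
        ?f (y + h) + ?f (y - h) - 2 * ?f y \<le> C * (norm h)\<^sup>2)" if "p \<in> chart_range c" for p
      using local_second_difference[OF u c(1) that] unfolding comp_def by metis
    then obtain d C where dC: "\<And>p. p \<in> chart_range c \<Longrightarrow> d p > 0"
      "\<And>p y h. p \<in> chart_range c \<Longrightarrow> y \<in> ball p (d p) \<Longrightarrow> norm h \<le> d p \<Longrightarrow>
        ?f (y + h) + ?f (y - h) - 2 * ?f y \<le> C p * (norm h)\<^sup>2"
      by metis
    have cover: "closure S \<subseteq> (\<Union>p\<in>closure S. ball p (d p))"
    proof
      fix y assume "y \<in> closure S"
      moreover from this have "d y > 0" using dC(1) S(4) by blast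
      ultimately show "y \<in> (\<Union>p\<in>closure S. ball p (d p))" by (intro UN_I[of y]) auto
    qed
    have "\<exists>P. P \<subseteq> closure S \<and> finite P \<and> closure S \<subseteq> (\<Union>p\<in>P. ball p (d p))"
      by (rule compactE_image[OF S(3) _ cover]) (simp, blast)
    then obtain P where P: "P \<subseteq> closure S" "finite P" "closure S \<subseteq> (\<Union>p\<in>P. ball p (d p))"
      by blast
    define M where "M = (\<Sum>p\<in>P. \<bar>C p\<bar>)"
    have "concave_on S (\<lambda>y. ?f y - M / 2 * (norm y)\<^sup>2)"
    proof (rule concave_on_if_locally_midpoint_concave[OF S(2,1)])
      show "continuous_on S (\<lambda>y. ?f y - M / 2 * (norm y)\<^sup>2)"
        by (rule continuous_on_diff[OF continuous_on_subset[OF cont order_trans[OF closure_subset S(4)]]])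
          (intro continuous_intros)
      fix y assume "y \<in> S"
      then obtain p where p: "p \<in> P" "y \<in> ball p (d p)" using P(3) closure_subset by blast
      have pr: "p \<in> chart_range c" using p(1) P(1) S(4) by blast
      have "C p \<le> M" unfolding M_def using member_le_sum[of p P "\<lambda>p. \<bar>C p\<bar>"] p(1) P(2) by simp
      have "(?f (y + h) - M / 2 * (norm (y + h))\<^sup>2) + (?f (y - h) - M / 2 * (norm (y - h))\<^sup>2)
          \<le> 2 * (?f y - M / 2 * (norm y)\<^sup>2)" if h: "norm h \<le> d p" for h
      proof -
        have parallelogram: "(norm (y + h))\<^sup>2 + (norm (y - h))\<^sup>2 = 2 * (norm y)\<^sup>2 + 2 * (norm h)\<^sup>2"
          by (simp add: power2_norm_eq_inner inner_simps inner_commute)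
        have "M / 2 * (norm (y + h))\<^sup>2 + M / 2 * (norm (y - h))\<^sup>2
            = M / 2 * ((norm (y + h))\<^sup>2 + (norm (y - h))\<^sup>2)"
          by (rule distrib_left[symmetric])
        also have "\<dots> = M * (norm y)\<^sup>2 + M * (norm h)\<^sup>2"
          unfolding parallelogram by (simp add: distrib_left)
        finally have "M / 2 * (norm (y + h))\<^sup>2 + M / 2 * (norm (y - h))\<^sup>2
            = M * (norm y)\<^sup>2 + M * (norm h)\<^sup>2" .
        moreover have "C p * (norm h)\<^sup>2 \<le> M * (norm h)\<^sup>2" using \<open>C p \<le> M\<close> by (rule mult_right_mono) simp
        ultimately show ?thesis using dC(2)[OF pr p(2) h] by simp
      qed
      then show "\<exists>e>0. \<forall>h. norm h \<le> e \<longrightarrow> (?f (y + h) - M / 2 * (norm (y + h))\<^sup>2)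
          + (?f (y - h) - M / 2 * (norm (y - h))\<^sup>2) \<le> 2 * (?f y - M / 2 * (norm y)\<^sup>2)"
        using dC(1)[OF pr] by blast
    qed
    then show ?thesis by blast
  qed
  then show "\<exists>c\<in>A. x \<in> chart_dom c \<and> locally_semiconcave_on (chart_range c) (u \<circ> chart_inv c)"
    unfolding locally_semiconcave_on_def using c cont by blast
qed

section \<open>The Riemannian distance\<close>

text \<open>Points in a common coordinate ball are joined by a segment, so both the set of points reachable
  from \<open>p\<close> and its complement are open.\<close>

lemma exists_curve:
  assumes "connected (UNIV :: 'm set)"
  obtains \<gamma> a b where "pw \<gamma> a b" "\<gamma> a = p" "\<gamma> b = q"
proof -
  define reach where "reach = {q. \<exists>\<gamma> a b. pw \<gamma> a b \<and> \<gamma> a = p \<and> \<gamma> b = q}"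
  have nbhd: "\<exists>W. open W \<and> q \<in> W \<and> (\<forall>q1\<in>W. \<forall>q2\<in>W. q1 \<in> reach \<longrightarrow> q2 \<in> reach)" for q
  proof -
    obtain c where c: "c \<in> A" "q \<in> chart_dom c" using exists_chart charts_at_iff by blast
    let ?z = "chart_map c q"
    obtain R l L B where K: "R > 0" "controlled c (cball ?z R) l L B"
      using exists_controlled_ball[OF c(1)] c(2) by blast
    note D = controlledD[OF K(2)]
    have sub: "ball ?z R \<subseteq> chart_range c" using D(2) ball_subset_cball by blast
    let ?W = "chart_inv c ` ball ?z R"
    have "q2 \<in> reach" if q: "q1 \<in> ?W" "q2 \<in> ?W" "q1 \<in> reach" for q1 q2
    proof -
      obtain x y where xy: "x \<in> ball ?z R" "y \<in> ball ?z R" "q1 = chart_inv c x" "q2 = chart_inv c y"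
        using q by blast
      have "F c z (y - x) \<le> L * norm (y - x)" if "z \<in> ball ?z R" for z using D(7) that by simp
      then obtain \<gamma>2 where 2: "pw \<gamma>2 0 1" "\<gamma>2 0 = q1" "\<gamma>2 1 = q2"
        using segment_curve[OF c(1) convex_ball sub xy(1,2)] xy(3,4) by metis
      obtain \<gamma>1 a b where 1: "pw \<gamma>1 a b" "\<gamma>1 a = p" "\<gamma>1 b = q1" using q(3) by (auto simp: reach_def)
      obtain \<gamma> e where "pw \<gamma> a e" "\<gamma> a = p" "\<gamma> e = q2"
        using pw_concat[OF 1(1) 2(1)] 1 2 by metis
      then show ?thesis unfolding reach_def by blast
    qed
    moreover have "q \<in> ?W" using c K(1) by (metis centre_in_ball chart_inv_map image_eqI)
    ultimately show ?thesis using open_chart_inv_image[OF c(1) open_ball sub] by blast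
  qed
  have op: "open reach"
  proof (subst open_subopen, intro ballI)
    fix q assume "q \<in> reach"
    then show "\<exists>T. open T \<and> q \<in> T \<and> T \<subseteq> reach" using nbhd[of q] by blast
  qed
  have cl: "open (- reach)"
  proof (subst open_subopen, intro ballI)
    fix q assume "q \<in> - reach"
    then show "\<exists>T. open T \<and> q \<in> T \<and> T \<subseteq> - reach" using nbhd[of q] by blast
  qed
  have "p \<in> reach" unfolding reach_def mem_Collect_eq
    by (rule exI[of _ "\<lambda>_. p"], rule exI[of _ 0], rule exI[of _ 0]) (simp add: pw_refl)
  then have "- reach = {}" using connectedD[OF assms op cl] by auto
  then have "q \<in> reach" by blast
  then obtain \<gamma> a b where "pw \<gamma> a b" "\<gamma> a = p" "\<gamma> b = q" unfolding reach_def by blast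
  then show ?thesis by (rule that)
qed

abbreviation d :: "'m \<Rightarrow> 'm \<Rightarrow> real" where
  "d \<equiv> riemannian_dist A g"

lemma dist_le_len:
  assumes "pw \<gamma> a b" shows "d (\<gamma> a) (\<gamma> b) \<le> len \<gamma> a b"
  unfolding riemannian_dist_def
proof (rule cInf_lower)
  let ?S = "{len \<kappa> s t |\<kappa> s t. pw \<kappa> s t \<and> \<kappa> s = \<gamma> a \<and> \<kappa> t = \<gamma> b}"
  show "len \<gamma> a b \<in> ?S" unfolding mem_Collect_eq
    by (rule exI[of _ \<gamma>], rule exI[of _ a], rule exI[of _ b]) (simp add: assms)
  show "bdd_below ?S" by (rule bdd_belowI[of _ 0]) (auto simp: len_nonneg)
qed

lemma dist_approx:
  assumes "connected (UNIV :: 'm set)" "e > 0"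
  obtains \<gamma> a b where "pw \<gamma> a b" "\<gamma> a = p" "\<gamma> b = q" "len \<gamma> a b < d p q + e"
proof -
  let ?S = "{len \<gamma> a b |\<gamma> a b. pw \<gamma> a b \<and> \<gamma> a = p \<and> \<gamma> b = q}"
  obtain \<gamma> a b where "pw \<gamma> a b" "\<gamma> a = p" "\<gamma> b = q" using exists_curve[OF assms(1)] .
  then have "?S \<noteq> {}" by blast
  then have "\<exists>s\<in>?S. s < d p q + e"
    unfolding riemannian_dist_def using assms(2) by (intro cInf_lessD) auto
  then obtain \<gamma> a b where "pw \<gamma> a b" "\<gamma> a = p" "\<gamma> b = q" "len \<gamma> a b < d p q + e" by blast
  then show ?thesis by (rule that)
qed

lemma dist_triangle:
  assumes "connected (UNIV :: 'm set)" shows "d p r \<le> d p q + d q r"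
proof (rule field_le_epsilon)
  fix e :: real assume e: "e > 0"
  obtain \<gamma>1 a b where 1: "pw \<gamma>1 a b" "\<gamma>1 a = p" "\<gamma>1 b = q" "len \<gamma>1 a b < d p q + e / 2"
    using dist_approx[OF assms, of "e / 2" p q] e by auto
  obtain \<gamma>2 a' b' where 2: "pw \<gamma>2 a' b'" "\<gamma>2 a' = q" "\<gamma>2 b' = r" "len \<gamma>2 a' b' < d q r + e / 2"
    using dist_approx[OF assms, of "e / 2" q r] e by auto
  obtain \<gamma> s where "pw \<gamma> a s" "\<gamma> a = p" "\<gamma> s = r" "len \<gamma> a s = len \<gamma>1 a b + len \<gamma>2 a' b'"
    using pw_concat[OF 1(1) 2(1)] 1 2 by metis
  then show "d p r \<le> d p q + d q r + e" using dist_le_len[of \<gamma> a s] 1(4) 2(4) by simp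
qed

end

section \<open>Busemann functions\<close>

locale busemann_setting = riemannian A g
  for A :: "('m::{t2_space, second_countable_topology}, 'e::euclidean_space) chart set"
    and g :: "('m, 'e) metric_tensor" +
  fixes \<gamma> :: "real \<Rightarrow> 'm"
  assumes connected: "connected (UNIV :: 'm set)"
    and ray_dist: "\<And>s t. 0 \<le> s \<Longrightarrow> 0 \<le> t \<Longrightarrow> d (\<gamma> s) (\<gamma> t) = \<bar>t - s\<bar>"
begin

abbreviation b :: "'m \<Rightarrow> real" where "b \<equiv> busemann A g \<gamma>"

lemma ray_excess_antimono:
  assumes "0 \<le> s" "s \<le> t" shows "d x (\<gamma> t) - t \<le> d x (\<gamma> s) - s"
  using dist_triangle[OF connected, of x "\<gamma> t" "\<gamma> s"] ray_dist[of s t] assms by simp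

lemma ray_excess_bounded:
  assumes "0 \<le> t" shows "- d (\<gamma> 0) x \<le> d x (\<gamma> t) - t"
  using dist_triangle[OF connected, of "\<gamma> 0" "\<gamma> t" x] ray_dist[of 0 t] assms by simp

text \<open>The function \<open>d x (\<gamma> t) - t\<close> decreases in \<open>t\<close> and is bounded below, so it converges to its infimum.\<close>

lemma busemann_limit:
  shows busemann_tendsto: "((\<lambda>t. d x (\<gamma> t) - t) \<longlongrightarrow> b x) at_top"
    and busemann_le: "0 \<le> t \<Longrightarrow> b x \<le> d x (\<gamma> t) - t"
proof -
  define I where "I = (INF t\<in>{0..}. d x (\<gamma> t) - t)"
  have bdd: "bdd_below ((\<lambda>t. d x (\<gamma> t) - t) ` {0..})"
    using ray_excess_bounded by (intro bdd_belowI2[of _ "- d (\<gamma> 0) x"]) auto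
  have I_le: "I \<le> d x (\<gamma> t) - t" if "0 \<le> t" for t
    unfolding I_def by (rule cINF_lower[OF bdd]) (use that in simp)
  have lim: "((\<lambda>t. d x (\<gamma> t) - t) \<longlongrightarrow> I) at_top"
  proof (rule tendstoI)
    fix e :: real assume "e > 0"
    then obtain s where s: "0 \<le> s" "d x (\<gamma> s) - s < I + e"
      using cINF_less_iff[OF _ bdd, of "I + e"] by (auto simp: I_def)
    have "dist (d x (\<gamma> t) - t) I < e" if "s \<le> t" for t
      using ray_excess_antimono[OF s(1) that, of x] I_le[of t] s that by (simp add: dist_real_def)
    then show "\<forall>\<^sub>F t in at_top. dist (d x (\<gamma> t) - t) I < e"
      unfolding eventually_at_top_linorder by blast
  qed
  then have "b x = I" unfolding busemann_def by (intro tendsto_Lim) auto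
  then show "((\<lambda>t. d x (\<gamma> t) - t) \<longlongrightarrow> b x) at_top" "0 \<le> t \<Longrightarrow> b x \<le> d x (\<gamma> t) - t"
    using lim I_le by auto
qed

lemma busemann_approx:
  assumes "e > 0"
  obtains t where "0 \<le> t" "s \<le> t" "d x (\<gamma> t) - t < b x + e"
proof -
  have "\<forall>\<^sub>F t in at_top. d x (\<gamma> t) - t < b x + e"
    using order_tendstoD(2)[OF busemann_tendsto] assms by simp
  then obtain N where "\<And>t. N \<le> t \<Longrightarrow> d x (\<gamma> t) - t < b x + e"
    unfolding eventually_at_top_linorder by blast
  then show ?thesis using that[of "max N (max 0 s)"] by simp
qed

lemma nonexpansive_busemann: "nonexpansive b"
  unfolding nonexpansive_def
proof (intro allI impI)
  fix \<kappa> a a' assume \<kappa>: "pw \<kappa> a a'"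
  show "b (\<kappa> a) \<le> b (\<kappa> a') + len \<kappa> a a'"
  proof (rule field_le_epsilon)
    fix e :: real assume "e > 0"
    then obtain t where "0 \<le> t" "d (\<kappa> a') (\<gamma> t) - t < b (\<kappa> a') + e" using busemann_approx by blast
    then show "b (\<kappa> a) \<le> b (\<kappa> a') + len \<kappa> a a' + e"
      using busemann_le[of t "\<kappa> a"] dist_triangle[OF connected, of "\<kappa> a" "\<gamma> t" "\<kappa> a'"] dist_le_len[OF \<kappa>]
      by linarith
  qed
qed

text \<open>Half of the error \<open>\<delta>\<close> pays for replacing \<open>b x\<close> by \<open>d x (\<gamma> t) - t\<close>, the other half for the excess of
  the length of \<open>\<kappa>\<close> over \<open>d x (\<gamma> t)\<close>. The lower bound on \<open>t\<close> ensures that \<open>\<kappa>\<close> has length at least \<open>r\<close>.\<close>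

lemma steepest_descent_busemann: "steepest_descent b"
  unfolding steepest_descent_def
proof (intro allI impI)
  fix x and r \<delta> :: real assume r: "0 < r" and \<delta>: "0 < \<delta>"
  obtain t where t: "0 \<le> t" "r + d (\<gamma> 0) x \<le> t" "d x (\<gamma> t) - t < b x + \<delta> / 2"
    using busemann_approx[of "\<delta> / 2"] \<delta> by (metis half_gt_zero)
  obtain \<kappa> a a' where \<kappa>: "pw \<kappa> a a'" "\<kappa> a = x" "\<kappa> a' = \<gamma> t" "len \<kappa> a a' < d x (\<gamma> t) + \<delta> / 2"
    using dist_approx[OF connected, of "\<delta> / 2"] \<delta> by (metis half_gt_zero)
  have "r \<le> len \<kappa> a a'"
    using ray_excess_bounded[OF t(1), of x] t(2) dist_le_len[OF \<kappa>(1)] \<kappa>(2,3) by simp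
  then obtain m where m: "m \<in> {a..a'}" "len \<kappa> a m = r"
    using IVT'[of "\<lambda>m. len \<kappa> a m" a r a'] r pw_le[OF \<kappa>(1)] continuous_on_len[OF \<kappa>(1)] len_refl
    by auto
  have pieces: "pw \<kappa> a m" "pw \<kappa> m a'" using pw_split[OF \<kappa>(1) m(1)] by auto
  have "d (\<kappa> m) (\<gamma> t) \<le> len \<kappa> a a' - r"
    using dist_le_len[OF pieces(2)] len_add[OF pieces] m(2) \<kappa>(3) by simp
  then have down: "b (\<kappa> m) \<le> b x - r + \<delta>" using busemann_le[OF t(1), of "\<kappa> m"] t(3) \<kappa>(4) by linarith
  show "\<exists>\<kappa> a a'. pw \<kappa> a a' \<and> \<kappa> a = x \<and> len \<kappa> a a' = r \<and> b (\<kappa> a') \<le> b x - r + \<delta>"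
    by (rule exI[of _ \<kappa>], rule exI[of _ a], rule exI[of _ m])
      (simp add: pieces(1) \<kappa>(2) m(2) down)
qed

end

theorem theorem1:
  fixes A :: "('m::{t2_space, second_countable_topology}, 'e::euclidean_space) chart set"
    and g :: "('m, 'e) metric_tensor"
    and \<gamma> :: "real \<Rightarrow> 'm"
  assumes "riemannian_manifold A g"
    and "connected (UNIV :: 'm set)"
    and "\<not> compact (UNIV :: 'm set)"
    and "complete_riemannian A g"
    and "ray A g \<gamma>"
  shows "(\<forall>x. ((\<lambda>t. riemannian_dist A g x (\<gamma> t) - t) \<longlongrightarrow> busemann A g \<gamma> x) at_top)
    \<and> viscosity_solution_gradient A g (busemann A g \<gamma>)
    \<and> viscosity_solution_differential A g (busemann A g \<gamma>)
    \<and> (\<forall>u. viscosity_solution_gradient A g u \<longleftrightarrow> viscosity_solution_differential A g u)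
    \<and> locally_semiconcave A (busemann A g \<gamma>)"
proof -
  interpret busemann_setting A g \<gamma>
    using assms by unfold_locales (auto simp: riemannian_manifold_def ray_def)
  note b = nonexpansive_busemann steepest_descent_busemann
  have grad: "viscosity_solution_gradient A g (busemann A g \<gamma>)"
    by (rule viscosity_solution_if_descent[OF b])
  then have "viscosity_solution_differential A g (busemann A g \<gamma>)"
    by (simp only: viscosity_gradient_iff_differential)
  then show ?thesis
    by (intro conjI allI busemann_tendsto grad viscosity_gradient_iff_differential
        locally_semiconcave_if_descent[OF b])
qed

end
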